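(* Let $n\ge 0$. Equip the set $\mathcal{CT}_n$ of coordinate-labelled trees with $n$ internal nodes with the coordinate-label distance $d_C$, and the set $\mathcal D_n$ of compact triangulations with $n$ internal vertices with the Hausdorff distance $d_H$. Then there exists a homeomorphism $\Psi_n:\mathcal{CT}_n\to\mathcal D_n$, $t\bullet\mapsto m$, such that: 1. Each internal node $u$ of $t\bullet$ corresponds bijectively to an internal vertex $M$ of $m$. Moreover, if $\lambda(u)=(\mathcal C(u),P(u))$ is the label at $u$, then the barycentric coordinates of $M$ with respect to $(A,B,C)$ are given by $\mathcal C(u).P(u)$. 2. Each leaf $l$ of $t\bullet$ corresponds bijectively to a face $f$ of $m$. Moreover, if $\mathcal C(l)=(\mathcal C_1,\mathcal C_2,\mathcal C_3)$ is the label at $l$ and $f$ is defined by the three ordered vertices $(A_f,B_f,C_f)$, then the barycentric coordinates of $A_f,B_f,C_f$ with respect to $(A,B,C)$ are $\mathcal C_1,\mathcal C_2,\mathcal C_3$ respectively.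
   Context: Triangle. $A=(0,0)$, $B=(1,0)$, $C=e^{i\pi/3}$ in $\mathbb R^2\cong\mathbb C$; $T=[AB]\cup[BC]\cup[CA]$, and $\tilde T$ is the filled (closed) triangle. Barycentric coordinates are normalised to have sum $1$. $V_2=\{x\in\mathbb R^3: x_i\ge 0,\ x_1+x_2+x_3=1\}$ and $V_2^*=\{x\in V_2: x_1,x_2,x_3>0\}$. Compact triangulations. $\mathcal D_0=\{T\}$, and $T$ has no internal vertices. For $m\in\mathcal D_k$, the faces of $m$ are the bounded connected components of $\mathbb R^2\setminus m$; there are $2k+1$ of them and each is the interior of a triangle with ordered vertices $(A_f,B_f,C_f)$. For $m=T$ the ordered vertices of the unique face are $(A,B,C)$. $\mathcal D_{k+1}$ is the set of all $m'=m\cup[A_fM]\cup[B_fM]\cup[C_fM]$ with $m\in\mathcal D_k$, $f$ a face of $m$, and $M$ a point of (the open triangle) $f$. The face $f$ is then replaced by three faces $f_1,f_2,f_3$ with ordered vertices $(M,B_f,C_f)$, $(A_f,M,C_f)$, $(A_f,B_f,M)$, the other faces being unchanged. The set of internal vertices is $\mathcal V(m')=\mathcal V(m)\cup\{M\}$ (the inserted points). $d_H$ is the Hausdorff distance on compact subsets of $\tilde T$. Trees. A (finite) ternary tree is a finite set $t$ of words on $\{1,2,3\}$ containing the empty word $\emptyset$ (the root), closed under removing the last letter, and such that each $u\in t$ has either no child in $t$ ($u$ is a leaf) or all three children $u(1),u(2),u(3)$ in $t$ ($u$ is an internal node). Coordinate-labelled trees. A coordinate-labelled tree is a pair $t\bullet=(t,(\lambda(u))_{u\in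 t})$ with $t=p(t\bullet)$ a finite ternary tree and labels such that: (a) for a leaf $l$, $\lambda(l)=\mathcal C(l)\in V_2^3$; (b) for an internal node $u$, $\lambda(u)=(\mathcal C(u),P(u))$ with $\mathcal C(u)\in V_2^3$ and $P(u)\in V_2^*$; (c) $\mathcal C(\emptyset)=([1,0,0],[0,1,0],[0,0,1])$; (d) if $u$ is internal with $\mathcal C(u)=(\mathcal C_1,\mathcal C_2,\mathcal C_3)$ and $P(u)=(P_1,P_2,P_3)$, then for $i\in\{1,2,3\}$, $\mathcal C(u(i))$ is obtained from $\mathcal C(u)$ by replacing its $i$-th entry with $\mathcal C(u).P(u):=P_1\mathcal C_1+P_2\mathcal C_2+P_3\mathcal C_3$. $\mathcal{CT}_n$ is the set of coordinate-labelled trees with $n$ internal nodes. Distance. For $t_1\bullet,t_2\bullet\in\mathcal{CT}_n$ with labels $\lambda_1,\lambda_2$: $d_C(t_1\bullet,t_2\bullet)=1$ if $p(t_1\bullet)\ne p(t_2\bullet)$, and $d_C(t_1\bullet,t_2\bullet)=1\wedge\max_{u\in p(t_1\bullet)} d(\lambda_1(u),\lambda_2(u))$ otherwise, where $d$ is a fixed distance (e.g. Euclidean) on labels viewed in $\mathbb R^i$. *)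

theory Defs
  imports "HOL-Analysis.Analysis"
begin

section \<open>Triples and barycentric coordinates\<close>

text \<open>Triples are indexed by the three-element type \<open>3\<close>, whose elements are \<open>1\<close>, \<open>2\<close> and \<open>3 = 0\<close>.\<close>

definition weighted_sum :: "'a::real_vector ^ 3 \<Rightarrow> real ^ 3 \<Rightarrow> 'a" where
  "weighted_sum v x = (\<Sum>i\<in>UNIV. x $ i *\<^sub>R v $ i)"

definition replace_entry :: "'a ^ 3 \<Rightarrow> 3 \<Rightarrow> 'a \<Rightarrow> 'a ^ 3" where
  "replace_entry v i p = (\<chi> j. if j = i then p else v $ j)"

definition barycentric_coords :: "complex ^ 3 \<Rightarrow> real ^ 3 \<Rightarrow> complex \<Rightarrow> bool" where
  "barycentric_coords v x z \<longleftrightarrow> (\<Sum>i\<in>UNIV. x $ i) = 1 \<and> z = weighted_sum v x"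

definition V2 :: "(real ^ 3) set" where
  "V2 = {x. (\<forall>i. 0 \<le> x $ i) \<and> (\<Sum>i\<in>UNIV. x $ i) = 1}"

definition V2_star :: "(real ^ 3) set" where
  "V2_star = {x \<in> V2. \<forall>i. 0 < x $ i}"


section \<open>Compact triangulations\<close>

definition ABC :: "complex ^ 3" where
  "ABC = vector [0, 1, cis (pi / 3)]"

definition base_triangle :: "complex set" where
  "base_triangle = closed_segment (ABC $ 1) (ABC $ 2) \<union> closed_segment (ABC $ 2) (ABC $ 3)
     \<union> closed_segment (ABC $ 3) (ABC $ 1)"

definition open_triangle :: "complex ^ 3 \<Rightarrow> complex set" where
  "open_triangle v = interior (convex hull (range (($) v)))"

definition faces :: "complex set \<Rightarrow> complex set set" where
  "faces m = {f \<in> components (- m). bounded f}"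

text \<open>
  The ordered vertices of the faces are a partial map \<open>\<sigma>\<close> from faces to triples of points. Both
  \<open>\<sigma>\<close> and the set \<open>V\<close> of internal vertices are built along an insertion history of the compact set
  \<open>m\<close>: \<open>triangulation_history k m \<sigma> V\<close> says that some history with \<open>k\<close> insertions produces \<open>m\<close>, and that
  the faces and internal vertices obtained along it are \<open>\<sigma>\<close> and \<open>V\<close>.
\<close>

definition split_face ::
  "(complex set \<rightharpoonup> complex ^ 3) \<Rightarrow> complex set \<Rightarrow> complex ^ 3 \<Rightarrow> complex
     \<Rightarrow> (complex set \<rightharpoonup> complex ^ 3)" where
  "split_face \<sigma> f v M = (\<sigma>(f := None))
     (open_triangle (replace_entry v 1 M) \<mapsto> replace_entry v 1 M,
      open_triangle (replace_entry v 2 M) \<mapsto> replace_entry v 2 M,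
      open_triangle (replace_entry v 3 M) \<mapsto> replace_entry v 3 M)"

inductive triangulation_history ::
  "nat \<Rightarrow> complex set \<Rightarrow> (complex set \<rightharpoonup> complex ^ 3) \<Rightarrow> complex set \<Rightarrow> bool" where
  base: "triangulation_history 0 base_triangle [open_triangle ABC \<mapsto> ABC] {}"
| insert: "triangulation_history k m \<sigma> V \<Longrightarrow> f \<in> faces m \<Longrightarrow> \<sigma> f = Some v \<Longrightarrow> M \<in> f \<Longrightarrow>
    triangulation_history (Suc k)
      (m \<union> closed_segment (v $ 1) M \<union> closed_segment (v $ 2) M \<union> closed_segment (v $ 3) M)
      (split_face \<sigma> f v M) (insert M V)"

definition compact_triangulations :: "nat \<Rightarrow> complex set set" where
  "compact_triangulations k = {m. \<exists>\<sigma> V. triangulation_history k m \<sigma> V}"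

text \<open>For nonempty compact arguments this is the Hausdorff distance.\<close>

definition hausdorff_dist :: "'a::metric_space set \<Rightarrow> 'a set \<Rightarrow> real" where
  "hausdorff_dist K L = max (SUP x\<in>K. infdist x L) (SUP y\<in>L. infdist y K)"


section \<open>Coordinate-labelled trees\<close>

text \<open>Words are lists read from the left, so the \<open>i\<close>-th child of \<open>u\<close> is \<open>u @ [i]\<close>.\<close>

definition ternary_tree :: "3 list set \<Rightarrow> bool" where
  "ternary_tree t \<longleftrightarrow> finite t \<and> [] \<in> t \<and> (\<forall>u i. u @ [i] \<in> t \<longrightarrow> u \<in> t)
     \<and> (\<forall>u\<in>t. (\<forall>i. u @ [i] \<notin> t) \<or> (\<forall>i. u @ [i] \<in> t))"

definition leaves :: "3 list set \<Rightarrow> 3 list set" where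
  "leaves t = {u \<in> t. \<forall>i. u @ [i] \<notin> t}"

definition internal_nodes :: "3 list set \<Rightarrow> 3 list set" where
  "internal_nodes t = {u \<in> t. \<forall>i. u @ [i] \<in> t}"

text \<open>The label of a leaf and the label of an internal node; the selector \<open>pnt\<close> is meant for the
  latter only.\<close>

datatype label = is_LeafLabel: LeafLabel (crd: "real ^ 3 ^ 3") | NodeLabel (crd: "real ^ 3 ^ 3") (pnt: "real ^ 3")

text \<open>Label functions are \<open>undefined\<close> outside the tree, so that a labelled tree is determined by its
  tree and the labels of its nodes.\<close>

definition coord_labelled_tree :: "3 list set \<times> (3 list \<Rightarrow> label) \<Rightarrow> bool" where
  "coord_labelled_tree = (\<lambda>(t, lam).
     ternary_tree t \<and> lam \<in> extensional t
     \<and> (\<forall>l\<in>leaves t. \<exists>C. lam l = LeafLabel C \<and> (\<forall>i. C $ i \<in> V2))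
     \<and> (\<forall>u\<in>internal_nodes t. \<exists>C P. lam u = NodeLabel C P \<and> (\<forall>i. C $ i \<in> V2) \<and> P \<in> V2_star)
     \<and> crd (lam []) = vector [vector [1, 0, 0], vector [0, 1, 0], vector [0, 0, 1]]
     \<and> (\<forall>u\<in>internal_nodes t. \<forall>i. crd (lam (u @ [i])) =
          replace_entry (crd (lam u)) i (weighted_sum (crd (lam u)) (pnt (lam u)))))"

definition CT :: "nat \<Rightarrow> (3 list set \<times> (3 list \<Rightarrow> label)) set" where
  "CT n = {(t, lam). coord_labelled_tree (t, lam) \<and> card (internal_nodes t) = n}"

text \<open>
  The distance on labels is given by its restrictions \<open>dl\<close> and \<open>dn\<close> to leaf labels and to labels of
  internal nodes, viewed in spaces of dimension 9 and 12. Labels of different kinds are never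
  compared when computing the distance of two trees, so the value \<open>1\<close> is irrelevant.
\<close>

fun label_dist ::
  "(real ^ 3 ^ 3 \<Rightarrow> real ^ 3 ^ 3 \<Rightarrow> real)
    \<Rightarrow> ((real ^ 3 ^ 3) \<times> (real ^ 3) \<Rightarrow> (real ^ 3 ^ 3) \<times> (real ^ 3) \<Rightarrow> real)
    \<Rightarrow> label \<Rightarrow> label \<Rightarrow> real" where
  "label_dist dl dn (LeafLabel C) (LeafLabel C') = dl C C'"
| "label_dist dl dn (NodeLabel C P) (NodeLabel C' P') = dn (C, P) (C', P')"
| "label_dist dl dn _ _ = 1"

definition tree_dist ::
  "(real ^ 3 ^ 3 \<Rightarrow> real ^ 3 ^ 3 \<Rightarrow> real)
    \<Rightarrow> ((real ^ 3 ^ 3) \<times> (real ^ 3) \<Rightarrow> (real ^ 3 ^ 3) \<times> (real ^ 3) \<Rightarrow> real)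
    \<Rightarrow> 3 list set \<times> (3 list \<Rightarrow> label) \<Rightarrow> 3 list set \<times> (3 list \<Rightarrow> label) \<Rightarrow> real" where
  "tree_dist dl dn = (\<lambda>(t1, lam1) (t2, lam2).
     if t1 \<noteq> t2 then 1 else min 1 (MAX u\<in>t1. label_dist dl dn (lam1 u) (lam2 u)))"

text \<open>The distances on a Euclidean space that induce its usual topology, among them \<open>dist\<close>.\<close>

definition usual_distance :: "('a::euclidean_space \<Rightarrow> 'a \<Rightarrow> real) \<Rightarrow> bool" where
  "usual_distance d \<longleftrightarrow> Metric_space UNIV d \<and> Metric_space.mtopology UNIV d = euclidean"

lemma usual_distance_dist: "usual_distance dist"
  by (simp add: usual_distance_def Met_TC.Metric_space_axioms)


section \<open>The topology of a distance on a set\<close>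

text \<open>
  The locale \<open>Metric_space M d\<close> wants \<open>d\<close> to be nonnegative and symmetric on the whole type. The
  values outside \<open>M\<close>, which do not influence the topology, are therefore set to \<open>0\<close>.
\<close>

definition restrict_dist :: "'a set \<Rightarrow> ('a \<Rightarrow> 'a \<Rightarrow> real) \<Rightarrow> 'a \<Rightarrow> 'a \<Rightarrow> real" where
  "restrict_dist M d x y = (if x \<in> M \<and> y \<in> M then d x y else 0)"

definition distance_topology :: "'a set \<Rightarrow> ('a \<Rightarrow> 'a \<Rightarrow> real) \<Rightarrow> 'a topology" where
  "distance_topology M d = Metric_space.mtopology M (restrict_dist M d)"

lemma Metric_space_restrict_dist:
  assumes "\<And>x y. x \<in> M \<Longrightarrow> y \<in> M \<Longrightarrow> 0 \<le> d x y"
    and "\<And>x y. x \<in> M \<Longrightarrow> y \<in> M \<Longrightarrow> d x y = d y x"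
    and "\<And>x y. x \<in> M \<Longrightarrow> y \<in> M \<Longrightarrow> d x y = 0 \<longleftrightarrow> x = y"
    and "\<And>x y z. x \<in> M \<Longrightarrow> y \<in> M \<Longrightarrow> z \<in> M \<Longrightarrow> d x z \<le> d x y + d y z"
  shows "Metric_space M (restrict_dist M d)"
  using assms by unfold_locales (auto simp: restrict_dist_def)


section \<open>Both spaces are metric spaces\<close>

lemma base_triangle_compact: "compact base_triangle" "base_triangle \<noteq> {}"
  by (auto simp: base_triangle_def intro!: compact_Un)

lemma triangulation_compact:
  "triangulation_history k m \<sigma> V \<Longrightarrow> compact m \<and> m \<noteq> {}"
  by (induction rule: triangulation_history.induct) (auto simp: base_triangle_compact intro!: compact_Un)

lemma bdd_above_infdist:
  assumes "compact K"
  shows "bdd_above ((\<lambda>x. infdist x L) ` K)"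
  by (intro bounded_imp_bdd_above compact_imp_bounded compact_continuous_image assms
      continuous_intros)

lemma infdist_le_hausdorff_dist:
  assumes "compact K" "x \<in> K"
  shows "infdist x L \<le> hausdorff_dist K L"
proof -
  have "infdist x L \<le> (SUP x\<in>K. infdist x L)"
    using assms bdd_above_infdist by (intro cSUP_upper) auto
  then show ?thesis by (simp add: hausdorff_dist_def)
qed

lemma hausdorff_dist_commute: "hausdorff_dist K L = hausdorff_dist L K"
  by (simp add: hausdorff_dist_def max.commute)

lemma hausdorff_dist_le:
  assumes "K \<noteq> {}" "L \<noteq> {}" "\<And>x. x \<in> K \<Longrightarrow> infdist x L \<le> r" "\<And>x. x \<in> L \<Longrightarrow> infdist x K \<le> r"
  shows "hausdorff_dist K L \<le> r"
  unfolding hausdorff_dist_def using assms by (auto intro!: cSUP_least)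

lemma infdist_triangle_hausdorff:
  fixes K L N :: "'a::heine_borel set"
  assumes "compact K" "compact L" "compact N" "L \<noteq> {}" "N \<noteq> {}" "x \<in> K"
  shows "infdist x N \<le> hausdorff_dist K L + hausdorff_dist L N"
proof -
  obtain y where y: "y \<in> L" "infdist x L = dist x y"
    using infdist_attains_inf[OF compact_imp_closed[OF assms(2)] assms(4), of x] by metis
  have "infdist x N \<le> infdist y N + dist x y"
    by (rule infdist_triangle)
  also have "\<dots> \<le> hausdorff_dist L N + hausdorff_dist K L"
    using infdist_le_hausdorff_dist[OF assms(2) y(1), of N]
      infdist_le_hausdorff_dist[OF assms(1) assms(6), of L] y(2) by linarith
  finally show ?thesis by simp
qed

lemma hausdorff_dist_nonneg:
  assumes "compact K" "K \<noteq> {}"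
  shows "0 \<le> hausdorff_dist K L"
proof -
  obtain x where "x \<in> K" using assms(2) by blast
  then show ?thesis
    using infdist_le_hausdorff_dist[OF assms(1), of x L] infdist_nonneg[of x L] by linarith
qed

lemma hausdorff_dist_0_subset:
  assumes "compact K" "compact L" "L \<noteq> {}" "hausdorff_dist K L = 0"
  shows "K \<subseteq> L"
proof
  fix x assume "x \<in> K"
  then have "infdist x L = 0"
    using infdist_le_hausdorff_dist[OF assms(1), of x L] infdist_nonneg[of x L] assms(4) by linarith
  then show "x \<in> L"
    using in_closed_iff_infdist_zero[OF compact_imp_closed[OF assms(2)] assms(3)] by blast
qed

lemma Metric_space_compact_triangulations:
  "Metric_space (compact_triangulations n) (restrict_dist (compact_triangulations n) hausdorff_dist)"
proof (rule Metric_space_restrict_dist)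
  have *: "compact K \<and> K \<noteq> {}" if "K \<in> compact_triangulations n" for K
    using that triangulation_compact by (auto simp: compact_triangulations_def)
  fix K L
  assume K: "K \<in> compact_triangulations n" and L: "L \<in> compact_triangulations n"
  show "0 \<le> hausdorff_dist K L" using * K hausdorff_dist_nonneg by blast
  show "hausdorff_dist K L = hausdorff_dist L K" by (rule hausdorff_dist_commute)
  show "hausdorff_dist K L = 0 \<longleftrightarrow> K = L"
  proof
    assume "hausdorff_dist K L = 0"
    then show "K = L"
      using hausdorff_dist_0_subset[of K L] hausdorff_dist_0_subset[of L K] *[OF K] *[OF L]
      by (auto simp: hausdorff_dist_commute)
  next
    assume "K = L"
    then have "hausdorff_dist K L \<le> 0"
      using *[OF K] by (intro hausdorff_dist_le) auto
    then show "hausdorff_dist K L = 0"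
      using hausdorff_dist_nonneg[of K L] *[OF K] by linarith
  qed
  fix N assume N: "N \<in> compact_triangulations n"
  show "hausdorff_dist K N \<le> hausdorff_dist K L + hausdorff_dist L N"
  proof (rule hausdorff_dist_le)
    show "infdist x N \<le> hausdorff_dist K L + hausdorff_dist L N" if "x \<in> K" for x
      using infdist_triangle_hausdorff[of K L N x] that *[OF K] *[OF L] *[OF N] by blast
    show "infdist x K \<le> hausdorff_dist K L + hausdorff_dist L N" if "x \<in> N" for x
      using infdist_triangle_hausdorff[of N L K x] that *[OF K] *[OF L] *[OF N]
      by (simp add: hausdorff_dist_commute add.commute)
  qed (use *[OF K] *[OF N] in auto)
qed

lemma label_dist_nonneg:
  assumes "Metric_space UNIV dl" "Metric_space UNIV dn"
  shows "0 \<le> label_dist dl dn a b"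
  using assms by (cases a; cases b) (auto simp: Metric_space_def)

lemma label_dist_commute:
  assumes "Metric_space UNIV dl" "Metric_space UNIV dn"
  shows "label_dist dl dn a b = label_dist dl dn b a"
  using assms by (cases a; cases b) (auto simp: Metric_space_def)

lemma label_dist_0_iff:
  assumes "Metric_space UNIV dl" "Metric_space UNIV dn"
  shows "label_dist dl dn a b = 0 \<longleftrightarrow> a = b"
  using assms by (cases a; cases b) (auto simp: Metric_space_def)

lemma label_dist_triangle:
  assumes "Metric_space UNIV dl" "Metric_space UNIV dn"
    and "is_LeafLabel a \<longleftrightarrow> is_LeafLabel b" "is_LeafLabel b \<longleftrightarrow> is_LeafLabel c"
  shows "label_dist dl dn a c \<le> label_dist dl dn a b + label_dist dl dn b c"
  using assms by (cases a; cases b; cases c) (auto simp: Metric_space_def)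

lemma CT_properties:
  assumes "(t, lam) \<in> CT n"
  shows "finite t" "t \<noteq> {}" "lam \<in> extensional t"
    and "u \<in> t \<Longrightarrow> is_LeafLabel (lam u) \<longleftrightarrow> u \<in> leaves t"
proof -
  have "coord_labelled_tree (t, lam)" using assms by (simp add: CT_def)
  note c = this[unfolded coord_labelled_tree_def prod.case]
  show "finite t" "t \<noteq> {}" "lam \<in> extensional t"
    using c by (auto simp: ternary_tree_def)
  assume u: "u \<in> t"
  have "u \<in> leaves t \<or> u \<in> internal_nodes t" "u \<notin> leaves t \<or> u \<notin> internal_nodes t"
    using u c by (auto simp: ternary_tree_def leaves_def internal_nodes_def)
  moreover have "is_LeafLabel (lam u)" if "u \<in> leaves t"
    using c that by (metis label.disc(1))
  moreover have "\<not> is_LeafLabel (lam u)" if "u \<in> internal_nodes t"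
    using c that by (metis label.disc(2))
  ultimately show "is_LeafLabel (lam u) \<longleftrightarrow> u \<in> leaves t"
    by blast
qed

lemma Metric_space_CT:
  assumes dl: "Metric_space UNIV dl" and dn: "Metric_space UNIV dn"
  shows "Metric_space (CT n) (restrict_dist (CT n) (tree_dist dl dn))"
proof (rule Metric_space_restrict_dist)
  let ?L = "label_dist dl dn"
  let ?d = "tree_dist dl dn"
  have upper: "min 1 (?L (lam u) (lam' u)) \<le> ?d (t, lam) (t, lam')"
    if "(t, lam) \<in> CT n" "u \<in> t" for t lam lam' u
  proof -
    have "?L (lam u) (lam' u) \<le> (MAX u\<in>t. ?L (lam u) (lam' u))"
      using CT_properties(1)[OF that(1)] that(2) by (intro Max_ge) auto
    then show ?thesis by (simp add: tree_dist_def min_le_iff_disj)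
  qed
  have attained: "\<exists>u\<in>t. ?d (t, lam) (t, lam') = min 1 (?L (lam u) (lam' u))"
    if "(t, lam) \<in> CT n" for t lam lam'
  proof -
    have "(MAX u\<in>t. ?L (lam u) (lam' u)) \<in> (\<lambda>u. ?L (lam u) (lam' u)) ` t"
      using CT_properties(1,2)[OF that] by (intro Max_in) auto
    then show ?thesis by (auto simp: tree_dist_def)
  qed
  have differ: "?d (t, lam) (t', lam') = 1" if "t \<noteq> t'" for t t' lam lam'
    using that by (simp add: tree_dist_def)
  have le1: "?d x y \<le> 1" for x y
    by (auto simp: tree_dist_def split: prod.splits)
  fix x y
  assume x: "x \<in> CT n" and y: "y \<in> CT n"
  have nonneg: "0 \<le> ?d x y" if x: "x \<in> CT n" for x y
  proof -
    obtain t lam t' lam' where xy: "x = (t, lam)" "y = (t', lam')" by (metis surj_pair)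
    show ?thesis
    proof (cases "t = t'")
      case True
      then obtain u where "?d x y = min 1 (?L (lam u) (lam' u))"
        using attained[of t lam lam'] x xy by auto
      then show ?thesis using label_dist_nonneg[OF dl dn] by simp
    qed (use xy differ in simp)
  qed
  show "0 \<le> ?d x y" using nonneg x .
  show "?d x y = ?d y x"
    by (auto simp: tree_dist_def label_dist_commute[OF dl dn] split: prod.splits)
  obtain t lam t' lam' where xy: "x = (t, lam)" "y = (t', lam')" by (metis surj_pair)
  show "?d x y = 0 \<longleftrightarrow> x = y"
  proof
    assume 0: "?d x y = 0"
    then have t: "t = t'" using xy differ[of t t' lam lam'] by (cases "t = t'") simp_all
    have "lam u = lam' u" if "u \<in> t" for u
    proof -
      have "min 1 (?L (lam u) (lam' u)) \<le> 0"
        using upper[of t lam u lam'] x xy 0 t that by simp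
      then have "?L (lam u) (lam' u) = 0"
        using label_dist_nonneg[OF dl dn, of "lam u" "lam' u"] by linarith
      then show ?thesis using label_dist_0_iff[OF dl dn] by simp
    qed
    then have "lam = lam'"
      using CT_properties(3)[of t lam n] CT_properties(3)[of t lam' n] x y xy t
      by (intro extensionalityI[of lam t lam']) auto
    then show "x = y" using xy t by simp
  next
    assume "x = y"
    then obtain u where "?d x y = min 1 (?L (lam u) (lam u))"
      using attained[of t lam lam] x xy by auto
    then show "?d x y = 0" using label_dist_0_iff[OF dl dn, of "lam u" "lam u"] by simp
  qed
  fix z assume z: "z \<in> CT n"
  obtain t'' lam'' where z': "z = (t'', lam'')" by (metis surj_pair)
  show "?d x z \<le> ?d x y + ?d y z"
  proof (cases "t = t' \<and> t' = t''")
    case True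
    then obtain u where u: "u \<in> t" "?d x z = min 1 (?L (lam u) (lam'' u))"
      using attained[of t lam lam''] x xy z' by auto
    have "?L (lam u) (lam'' u) \<le> ?L (lam u) (lam' u) + ?L (lam' u) (lam'' u)"
      using CT_properties(4)[of t lam n u] CT_properties(4)[of t lam' n u]
        CT_properties(4)[of t lam'' n u] u(1) x y z xy z' True
      by (intro label_dist_triangle[OF dl dn]) simp_all
    moreover have "0 \<le> ?L (lam u) (lam' u)" "0 \<le> ?L (lam' u) (lam'' u)"
      using label_dist_nonneg[OF dl dn] by auto
    moreover have "min 1 (?L (lam u) (lam' u)) \<le> ?d x y" "min 1 (?L (lam' u) (lam'' u)) \<le> ?d y z"
      using upper[of t lam u lam'] upper[of t lam' u lam''] x y xy z' True u(1) by auto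
    ultimately show ?thesis using u(2) by linarith
  next
    case False
    then have "?d x y = 1 \<or> ?d y z = 1" using differ xy z' by metis
    then show ?thesis
      using le1[of x z] nonneg[OF x, of y] nonneg[OF y, of z] by linarith
  qed
qed

end

theory Submission
  imports Defs
begin

text \<open>
  A tree with points \<open>P(u)\<close> at its internal nodes is sent to the union of the base triangle and the
  segments from the corners of each node's triangle to its point. Leaf triangles of the drawing are
  pairwise disjoint and disjoint from it, and together with it they cover the base triangle, so the
  faces are exactly the nonempty open leaf triangles; this holds even if the points lie in the
  closed simplex \<open>V2\<close>.

  Injectivity rests on the fact that the segments drawn inside a triangle meet its sides only at the
  corners: hence no segment from a corner to an interior point of the opposite side is drawn. If two
  drawings had different points at the root, one of the segments from a corner to the second point
  would contain such a segment in a part of the first subdivision.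

  For the continuity of the inverse, a Hausdorff-convergent sequence of drawings has a subsequence
  with constant tree and points converging in the compact set \<open>V2\<close>. The limit drawing has the
  maximal number of faces, which forces the limit points to be interior; injectivity then
  identifies them.
\<close>

section \<open>Ternary trees\<close>

text \<open>The triples in the labels carry no information beyond the points: one recursion computes
  them, run on the standard basis of R^3 for the labels and on \<open>ABC\<close> for the drawing.
  As \<open>weighted_sum ABC\<close> is linear and takes the first triangle to the second, the
  claims on barycentric coordinates hold at all nodes at once, and the remaining argument can work
  with a tree and a function giving its points.

  A compact set may have several insertion histories, since points in different faces can be
  inserted in any order. Its ordered faces and internal vertices are therefore not visibly
  determined by it. Each history is matched with some tree, and injectivity makes this tree the
  given one.

  The position of a second point \<open>P'\<close> in the subdivision at \<open>P\<close> is decided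
  by the three ratios \<open>P' $ l / P $ l\<close>: the smallest one names the part. If the two
  larger ratios coincide, the segment from the vertex of the smallest one to \<open>P'\<close>
  passes through the point of \<open>P\<close> and crosses no other part. The roles of the two
  points must then be exchanged.\<close>

definition subtree :: "3 \<Rightarrow> 3 list set \<Rightarrow> 3 list set" where
  "subtree i t = {u. i # u \<in> t}"

lemma ternary_tree_prefix:
  assumes "ternary_tree t" "u @ w \<in> t"
  shows "u \<in> t"
  using assms(2)
proof (induction w rule: rev_induct)
  case (snoc i w)
  then have "(u @ w) @ [i] \<in> t" by simp
  then show ?case using assms(1) snoc.IH unfolding ternary_tree_def by blast
qed simp

lemma ternary_tree_leaf_or_internal:
  assumes "ternary_tree t" "u \<in> t"
  shows "u \<in> leaves t \<longleftrightarrow> u \<notin> internal_nodes t"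
  using assms by (auto simp: ternary_tree_def leaves_def internal_nodes_def)

lemma ternary_tree_finite:
  assumes "ternary_tree t"
  shows "finite t" "finite (leaves t)" "finite (internal_nodes t)"
  using assms by (auto simp: ternary_tree_def leaves_def internal_nodes_def)

lemma leaves_subset: "leaves t \<subseteq> t"
  and internal_nodes_subset: "internal_nodes t \<subseteq> t"
  by (auto simp: leaves_def internal_nodes_def)

lemma ternary_tree_subtree:
  assumes "ternary_tree t" "[] \<in> internal_nodes t"
  shows "ternary_tree (subtree i t)"
proof -
  have "inj ((#) i)" by (rule inj_onI) simp
  then have "finite ((#) i -` t)"
    using assms(1) by (intro finite_vimageI) (auto simp: ternary_tree_def)
  then have "finite (subtree i t)" by (simp add: subtree_def vimage_def)
  moreover have "[] \<in> subtree i t"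
    using assms(2) by (auto simp: subtree_def internal_nodes_def)
  ultimately show ?thesis
    using assms(1) unfolding ternary_tree_def subtree_def
    by (metis append_Cons mem_Collect_eq)
qed

lemma ternary_tree_singleton: "ternary_tree {[]}" "leaves {[]} = {[]}" "internal_nodes {[]} = {}"
  by (auto simp: ternary_tree_def leaves_def internal_nodes_def)

lemma ternary_tree_root_leaf:
  assumes "ternary_tree t" "[] \<notin> internal_nodes t"
  shows "t = {[]}"
proof -
  have root: "[] \<in> t" using assms(1) by (simp add: ternary_tree_def)
  then have "[] \<in> leaves t" using assms ternary_tree_leaf_or_internal by blast
  then have "[i] \<notin> t" for i by (auto simp: leaves_def)
  then have "i # u \<notin> t" for i u
    using ternary_tree_prefix[OF assms(1), of "[i]" u] by auto
  then show ?thesis using root by (metis empty_iff insertCI insertE list.exhaust subsetI subset_antisym)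
qed

lemma internal_nodes_Cons: "i # u \<in> internal_nodes t \<longleftrightarrow> u \<in> internal_nodes (subtree i t)"
  and leaves_Cons: "i # u \<in> leaves t \<longleftrightarrow> u \<in> leaves (subtree i t)"
  by (auto simp: internal_nodes_def leaves_def subtree_def)

lemma internal_nodes_decompose:
  assumes "[] \<in> internal_nodes t"
  shows "internal_nodes t = insert [] (\<Union>i. (#) i ` internal_nodes (subtree i t))" (is "_ = ?R")
proof (rule set_eqI)
  show "u \<in> internal_nodes t \<longleftrightarrow> u \<in> ?R" for u
    by (cases u) (use assms internal_nodes_Cons in auto)
qed

lemma leaves_decompose:
  assumes "[] \<in> internal_nodes t"
  shows "leaves t = (\<Union>i. (#) i ` leaves (subtree i t))" (is "_ = ?R")
proof (rule set_eqI)
  show "u \<in> leaves t \<longleftrightarrow> u \<in> ?R" for u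
    by (cases u) (use assms leaves_Cons in \<open>auto simp: leaves_def internal_nodes_def\<close>)
qed

lemma ternary_tree_decompose:
  assumes "[] \<in> internal_nodes t"
  shows "t = insert [] (\<Union>i. (#) i ` subtree i t)" (is "_ = ?R")
proof (rule set_eqI)
  show "u \<in> t \<longleftrightarrow> u \<in> ?R" for u
    by (cases u) (use assms in \<open>auto simp: subtree_def internal_nodes_def\<close>)
qed

text \<open>Words grow on the right in \<open>ternary_tree\<close>, whereas the geometry passes from
  the root triangle to its three parts. This induction strips the first letter instead; it is well
  founded because a subtree has no copy of the root.\<close>

lemma ternary_tree_induct [consumes 1, case_names leaf node]:
  assumes "ternary_tree t"
    and "P {[]}"
    and "\<And>t. ternary_tree t \<Longrightarrow> [] \<in> internal_nodes t \<Longrightarrow> (\<And>i. ternary_tree (subtree i t)) \<Longrightarrow>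
      (\<And>i. P (subtree i t)) \<Longrightarrow> P t"
  shows "P t"
  using assms(1)
proof (induction "card t" arbitrary: t rule: less_induct)
  case less
  show ?case
  proof (cases "[] \<in> internal_nodes t")
    case True
    have sub: "ternary_tree (subtree i t)" for i
      using ternary_tree_subtree[OF less.prems True] .
    have "card (subtree i t) < card t" for i
    proof -
      have "(#) i ` subtree i t \<subset> t"
        using True by (auto simp: subtree_def internal_nodes_def)
      then have "card ((#) i ` subtree i t) < card t"
        using ternary_tree_finite(1)[OF less.prems] by (rule psubset_card_mono[rotated])
      then show ?thesis by (simp add: card_image)
    qed
    then show ?thesis using less sub True assms(3) by blast
  next
    case False
    then show ?thesis using ternary_tree_root_leaf[OF less.prems] assms(2) by simp
  qed
qed

text \<open>Gives the number \<open>2n + 1\<close> of faces. It depends on \<open>n\<close> only,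
  which allows drawings of different trees to be compared by counting faces.\<close>

lemma card_leaves:
  assumes "ternary_tree t"
  shows "card (leaves t) = 2 * card (internal_nodes t) + 1"
  using assms
proof (induction rule: ternary_tree_induct)
  case leaf
  then show ?case by (simp add: ternary_tree_singleton)
next
  case (node t)
  have card_UN: "card (\<Union>i. (#) i ` A i) = (\<Sum>i\<in>UNIV. card (A i))"
    if "\<And>i. finite (A i)" for A :: "3 \<Rightarrow> 3 list set"
    using that by (subst card_UN_disjoint) (auto simp: card_image)
  have "card (leaves t) = (\<Sum>i\<in>UNIV. card (leaves (subtree i t)))"
    using leaves_decompose[OF node(2)] card_UN ternary_tree_finite node(3) by simp
  moreover have "card (internal_nodes t) = Suc (\<Sum>i\<in>UNIV. card (internal_nodes (subtree i t)))"
    using internal_nodes_decompose[OF node(2)] card_UN ternary_tree_finite node(3)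
    by (simp add: card_insert_if image_iff)
  ultimately show ?case by (simp add: node(4) sum_3)
qed

text \<open>A longest extension of \<open>u\<close> inside the tree has no child.\<close>

lemma leaf_below:
  assumes "ternary_tree t" "u \<in> t"
  shows "\<exists>w. u @ w \<in> leaves t"
proof -
  let ?W = "{w. u @ w \<in> t}"
  have "inj ((@) u)" by (rule inj_onI) simp
  then have fin: "finite ?W"
    using finite_vimageI[of t "(@) u"] ternary_tree_finite(1)[OF assms(1)] by (simp add: vimage_def)
  have "?W \<noteq> {}" using assms(2) by (auto intro: exI[of _ "[]"])
  then obtain w where w: "w \<in> ?W" "length w = Max (length ` ?W)"
    using Max_in[of "length ` ?W"] fin by (metis (no_types, lifting) empty_is_image finite_imageI imageE)
  have "(u @ w) @ [i] \<notin> t" for i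
  proof
    assume "(u @ w) @ [i] \<in> t"
    then have "length (w @ [i]) \<le> Max (length ` ?W)"
      using fin by (intro Max_ge imageI) auto
    then show False using w(2) by simp
  qed
  then show ?thesis using w(1) by (auto simp: leaves_def)
qed

lemma prefix_internal:
  assumes "ternary_tree t" "u @ i # w \<in> t"
  shows "u \<in> internal_nodes t"
proof -
  have "u @ [i] \<in> t" using ternary_tree_prefix[OF assms(1), of "u @ [i]" w] assms(2) by simp
  then show ?thesis using assms(1) unfolding ternary_tree_def internal_nodes_def by blast
qed

text \<open>The proper prefixes of a node are internal nodes of distinct lengths. Trees with
  \<open>n\<close> internal nodes thus use words of length at most \<open>n\<close>, so there are
  finitely many of them, as the later pigeonhole argument requires.\<close>

lemma length_le_card_internal:
  assumes "ternary_tree t" "u \<in> t"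
  shows "length u \<le> card (internal_nodes t)"
proof -
  have "(\<lambda>k. take k u) ` {..<length u} \<subseteq> internal_nodes t"
  proof safe
    fix k assume "k < length u"
    then show "take k u \<in> internal_nodes t"
      using prefix_internal[OF assms(1), of "take k u" "u ! k" "drop (Suc k) u"] assms(2)
        id_take_nth_drop[of k u] by metis
  qed
  moreover have "inj_on (\<lambda>k. take k u) {..<length u}"
  proof (rule inj_onI)
    fix j k assume jk: "j \<in> {..<length u}" "k \<in> {..<length u}" and "take j u = take k u"
    then have "length (take j u) = length (take k u)" by metis
    then show "j = k" using jk by simp
  qed
  ultimately show ?thesis
    using card_inj_on_le[of "\<lambda>k. take k u" "{..<length u}" "internal_nodes t"]
      ternary_tree_finite(3)[OF assms(1)] by simp
qed

lemma finite_ternary_trees: "finite {t. ternary_tree t \<and> card (internal_nodes t) = n}"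
proof (rule finite_subset)
  show "{t. ternary_tree t \<and> card (internal_nodes t) = n} \<subseteq> Pow {u. set u \<subseteq> UNIV \<and> length u \<le> n}"
    using length_le_card_internal by auto
  show "finite (Pow {u :: 3 list. set u \<subseteq> UNIV \<and> length u \<le> n})"
    using finite_lists_length_le[of "UNIV :: 3 set" n] by simp
qed

section \<open>Growing and pruning a tree at a leaf\<close>

lemma grow_leaf:
  assumes "ternary_tree t" "l \<in> leaves t"
  defines "t' \<equiv> t \<union> range (\<lambda>i. l @ [i])"
  shows "ternary_tree t'" "internal_nodes t' = insert l (internal_nodes t)"
    "leaves t' = leaves t - {l} \<union> range (\<lambda>i. l @ [i])" "l \<notin> internal_nodes t"
proof -
  have l: "l \<in> t" "l @ w \<in> t \<Longrightarrow> w = []" for w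
  proof -
    show "l \<in> t" using assms(2) leaves_subset by blast
    assume "l @ w \<in> t"
    then show "w = []"
      using prefix_internal[OF assms(1), of l] ternary_tree_leaf_or_internal[OF assms(1), of l]
        assms(2) leaves_subset by (cases w) auto
  qed
  have new: "l @ [i] \<notin> t" "l @ [i, j] \<notin> t" for i j using l(2) by blast+
  show "ternary_tree t'" unfolding ternary_tree_def
  proof (intro conjI allI ballI impI)
    show "finite t'" using ternary_tree_finite[OF assms(1)] by (simp add: t'_def)
    show "[] \<in> t'" using assms(1) by (simp add: t'_def ternary_tree_def)
    show "u \<in> t'" if "u @ [i] \<in> t'" for u i
      using that l(1) ternary_tree_prefix[OF assms(1), of u "[i]"] by (auto simp: t'_def)
    show "(\<forall>i. u @ [i] \<notin> t') \<or> (\<forall>i. u @ [i] \<in> t')" if "u \<in> t'" for u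
      using that assms(1) new unfolding ternary_tree_def t'_def by auto
  qed
  show "l \<notin> internal_nodes t" using assms(2) by (auto simp: leaves_def internal_nodes_def)
  show "internal_nodes t' = insert l (internal_nodes t)"
    using l(1) new by (auto simp: internal_nodes_def t'_def)
  show "leaves t' = leaves t - {l} \<union> range (\<lambda>i. l @ [i])"
    using l(1) new by (auto simp: leaves_def t'_def)
qed

text \<open>An internal node of maximal length has only leaves as children, so removing these leaves
  a tree. It plays the part of the last insertion when a history is built from a tree.\<close>

lemma ungrow_leaf:
  assumes "ternary_tree t" "internal_nodes t \<noteq> {}"
  obtains s l where "ternary_tree s" "l \<in> leaves s" "t = s \<union> range (\<lambda>i. l @ [i])"
proof -
  have fin: "finite (internal_nodes t)" using ternary_tree_finite[OF assms(1)] by simp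
  obtain l where l: "l \<in> internal_nodes t" "length l = Max (length ` internal_nodes t)"
    using Max_in[of "length ` internal_nodes t"] fin assms(2)
    by (metis (no_types, lifting) empty_is_image finite_imageI imageE)
  have deep: "l @ i # j # w \<notin> t" for i j w
  proof
    assume "l @ i # j # w \<in> t"
    then have "l @ [i] \<in> internal_nodes t"
      using prefix_internal[OF assms(1), of "l @ [i]" j w] by simp
    then have "length (l @ [i]) \<le> Max (length ` internal_nodes t)"
      using fin by (intro Max_ge imageI) auto
    then show False using l(2) by simp
  qed
  define s where "s = t - range (\<lambda>i. l @ [i])"
  have "ternary_tree s" unfolding ternary_tree_def
  proof (intro conjI allI ballI impI)
    show "finite s" using ternary_tree_finite[OF assms(1)] by (simp add: s_def)
    show "[] \<in> s" using assms(1) by (auto simp: s_def ternary_tree_def)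
    show "u \<in> s" if "u @ [i] \<in> s" for u i
    proof -
      have "u \<in> t" using that ternary_tree_prefix[OF assms(1), of u "[i]"] by (auto simp: s_def)
      moreover have "u \<noteq> l @ [j]" for j using that deep[of j i "[]"] by (auto simp: s_def)
      ultimately show ?thesis by (auto simp: s_def)
    qed
    show "(\<forall>i. u @ [i] \<notin> s) \<or> (\<forall>i. u @ [i] \<in> s)" if "u \<in> s" for u
      using that assms(1) unfolding ternary_tree_def s_def by auto
  qed
  moreover have "l \<in> leaves s"
    using l(1) by (auto simp: leaves_def s_def internal_nodes_def)
  moreover have "t = s \<union> range (\<lambda>i. l @ [i])"
    using l(1) by (auto simp: s_def internal_nodes_def)
  ultimately show ?thesis using that by blast
qed

section \<open>Barycentric geometry of triangles\<close>

lemma distinct_indices: "i \<noteq> j \<Longrightarrow> j \<noteq> k \<Longrightarrow> i \<noteq> k \<Longrightarrow> l = i \<or> l = j \<or> l = (k :: 3)"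
  using exhaust_3[of i] exhaust_3[of j] exhaust_3[of k] exhaust_3[of l] by auto

lemma other_indices: obtains j k :: 3 where "i \<noteq> j" "j \<noteq> k" "i \<noteq> k"
  using exhaust_3[of i] that[of 1 2] that[of 2 3] that[of 3 1] by force

lemma sum_distinct_indices:
  fixes f :: "3 \<Rightarrow> 'a::comm_monoid_add"
  assumes "i \<noteq> j" "j \<noteq> k" "i \<noteq> k"
  shows "(\<Sum>l\<in>UNIV. f l) = f i + f j + f k"
proof -
  have "(\<Sum>l\<in>UNIV. f l) = (\<Sum>l\<in>{i, j, k}. f l)"
    using distinct_indices[OF assms] by (intro sum.cong) auto
  then show ?thesis using assms by (simp add: add.assoc)
qed

lemma linear_weighted_sum: "linear (weighted_sum v)"
  by (rule linearI) (simp_all add: weighted_sum_def sum.distrib scaleR_left_distrib scaleR_sum_right)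

lemma convex_V2: "convex V2"
  by (auto simp: convex_def V2_def sum.distrib sum_distrib_left[symmetric])

lemma V2_star_subset: "V2_star \<subseteq> V2" by (auto simp: V2_star_def)

lemma V2_D: "x \<in> V2 \<Longrightarrow> 0 \<le> x $ i" "x \<in> V2 \<Longrightarrow> (\<Sum>i\<in>UNIV. x $ i) = 1"
  and V2_star_D: "x \<in> V2_star \<Longrightarrow> 0 < x $ i" "x \<in> V2_star \<Longrightarrow> (\<Sum>i\<in>UNIV. x $ i) = 1"
  by (simp_all add: V2_def V2_star_def)

lemma axis_V2: "axis i 1 \<in> V2"
  by (auto simp: V2_def axis_def if_distrib cong: if_cong)

lemma weighted_sum_axis: "weighted_sum v (axis i 1) = v $ i"
  by (simp add: weighted_sum_def axis_def if_distrib[of "\<lambda>c. c *\<^sub>R _"] cong: if_cong)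

lemma hull_eq_weighted_sum:
  fixes v :: "'a::real_vector ^ 3"
  shows "convex hull (range (($) v)) = weighted_sum v ` V2"
proof (rule hull_unique)
  show "range (($) v) \<subseteq> weighted_sum v ` V2"
    using axis_V2 weighted_sum_axis[of v] by (metis image_eqI image_subsetI)
  show "convex (weighted_sum v ` V2)"
    by (rule convex_linear_image[OF linear_weighted_sum convex_V2])
  fix S assume S: "range (($) v) \<subseteq> S" "convex S"
  show "weighted_sum v ` V2 \<subseteq> S"
    using S by (auto simp: weighted_sum_def V2_def intro!: convex_sum)
qed

definition boundary_weights :: "(real ^ 3) set" where
  "boundary_weights = {x \<in> V2. \<exists>i. x $ i = 0}"

text \<open>Given through weights rather than segments, so that perimeter, interior and hull can be
  compared in barycentric coordinates; \<open>edges_eq_segments\<close> recovers the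
  segments.\<close>

definition edges :: "'a::real_vector ^ 3 \<Rightarrow> 'a set" where
  "edges v = weighted_sum v ` boundary_weights"

lemma V2_eq: "V2 = V2_star \<union> boundary_weights"
  by (auto simp: V2_star_def boundary_weights_def V2_def less_le)

lemma edges_subset_hull: "edges v \<subseteq> convex hull (range (($) v))"
  by (auto simp: hull_eq_weighted_sum edges_def boundary_weights_def)

lemma edges_eq_segments: "edges v = (\<Union>i j. closed_segment (v $ i) (v $ j))"
proof (intro equalityI subsetI)
  fix z assume "z \<in> edges v"
  then obtain x i where x: "x \<in> V2" "x $ i = 0" and z: "z = weighted_sum v x"
    by (auto simp: edges_def boundary_weights_def)
  obtain j k where ijk: "i \<noteq> j" "j \<noteq> k" "i \<noteq> k" using other_indices by metis
  have "0 \<le> x $ j" "0 \<le> x $ k" "x $ j = 1 - x $ k"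
    using x unfolding V2_def sum_distinct_indices[OF ijk] by auto
  moreover have "z = x $ j *\<^sub>R v $ j + x $ k *\<^sub>R v $ k"
    using x(2) by (simp add: z weighted_sum_def sum_distinct_indices[OF ijk])
  ultimately have "z = (1 - x $ k) *\<^sub>R v $ j + x $ k *\<^sub>R v $ k" "0 \<le> x $ k" "x $ k \<le> 1"
    by auto
  then show "z \<in> (\<Union>i j. closed_segment (v $ i) (v $ j))" by (auto simp: closed_segment_def)
next
  fix z assume "z \<in> (\<Union>i j. closed_segment (v $ i) (v $ j))"
  then obtain i j u where u: "0 \<le> u" "u \<le> 1" and z: "z = (1 - u) *\<^sub>R v $ i + u *\<^sub>R v $ j"
    by (auto simp: closed_segment_def)
  have "z = weighted_sum v ((1 - u) *\<^sub>R axis i 1 + u *\<^sub>R axis j 1)"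
    by (simp add: z linear_add[OF linear_weighted_sum] linear_scale[OF linear_weighted_sum] weighted_sum_axis)
  moreover have "(1 - u) *\<^sub>R axis i 1 + u *\<^sub>R axis j 1 \<in> V2"
    using convexD_alt[OF convex_V2 axis_V2 axis_V2 u] by simp
  moreover have "\<exists>k. k \<noteq> i \<and> k \<noteq> j" using exhaust_3[of i] exhaust_3[of j]
    by (metis other_indices)
  then have "\<exists>k. ((1 - u) *\<^sub>R axis i 1 + u *\<^sub>R axis j 1 :: real ^ 3) $ k = 0"
    by (auto simp: axis_def)
  ultimately show "z \<in> edges v" unfolding edges_def boundary_weights_def by blast
qed

lemma base_triangle_eq: "base_triangle = edges ABC"
  unfolding edges_eq_segments base_triangle_def UNIV_3
  by (auto simp: closed_segment_commute)

text \<open>Affine dependence of the three vertices. Coefficients of sum zero are used because they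
  can be carried through the change of weights of a subdivision.\<close>

definition degenerate :: "'a::real_vector ^ 3 \<Rightarrow> bool" where
  "degenerate v \<longleftrightarrow> (\<exists>d. d \<noteq> 0 \<and> (\<Sum>i\<in>UNIV. d $ i) = 0 \<and> weighted_sum v d = 0)"

lemma barycentric_unique:
  assumes "\<not> degenerate v" "x \<in> V2" "y \<in> V2" "weighted_sum v x = weighted_sum v y"
  shows "x = y"
proof (rule ccontr)
  assume "x \<noteq> y"
  then have "x - y \<noteq> 0" by simp
  moreover have "(\<Sum>i\<in>UNIV. (x - y) $ i) = 0"
    using assms by (simp add: V2_def sum_subtractf)
  moreover have "weighted_sum v (x - y) = 0"
    using assms by (simp add: linear_diff[OF linear_weighted_sum])
  ultimately show False using assms(1) unfolding degenerate_def by blast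
qed

text \<open>Subtracting a multiple of the dependence \<open>d\<close> from the weights does not move
  the point. The largest multiple that keeps all weights nonnegative makes one of them zero, so
  every point of a flat triangle is on its perimeter.\<close>

lemma degenerate_hull_subset_edges:
  assumes "degenerate v"
  shows "convex hull (range (($) v)) \<subseteq> edges v"
proof -
  obtain d where d: "d \<noteq> 0" "(\<Sum>i\<in>UNIV. d $ i) = 0" "weighted_sum v d = 0"
    using assms by (auto simp: degenerate_def)
  have "\<exists>i. d $ i > 0"
  proof (rule ccontr)
    assume "\<nexists>i. d $ i > 0"
    then have "d $ i \<le> 0" for i by (meson not_le)
    then have "d $ i = 0" for i
      using sum_nonneg_eq_0_iff[of UNIV "\<lambda>i. - d $ i"] d(2) by (simp add: sum_negf)
    then show False using d(1) by (simp add: vec_eq_iff)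
  qed
  then have pos: "{i. d $ i > 0} \<noteq> {}" by simp
  have "weighted_sum v x \<in> edges v" if x: "x \<in> V2" for x
  proof -
    define s where "s = Min ((\<lambda>i. x $ i / d $ i) ` {i. d $ i > 0})"
    have "s \<in> (\<lambda>i. x $ i / d $ i) ` {i. d $ i > 0}"
      unfolding s_def using pos by (intro Min_in) auto
    then obtain i where i: "d $ i > 0" "s = x $ i / d $ i" by auto
    have s0: "s \<ge> 0" using i x by (simp add: V2_def)
    have le: "s * d $ j \<le> x $ j" for j
    proof (cases "d $ j > 0")
      case True
      then have "s \<le> x $ j / d $ j" unfolding s_def by (intro Min_le) auto
      then show ?thesis using True by (simp add: pos_le_divide_eq)
    next
      case False
      then have "s * d $ j \<le> 0" using s0 by (simp add: mult_nonneg_nonpos)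
      then show ?thesis using x by (simp add: V2_def) (metis order_trans)
    qed
    have "(\<Sum>j\<in>UNIV. (x - s *\<^sub>R d) $ j) = 1"
      using x d(2) by (simp add: V2_def sum_subtractf sum_distrib_left[symmetric])
    moreover have "(x - s *\<^sub>R d) $ i = 0" using i by simp
    ultimately have "x - s *\<^sub>R d \<in> boundary_weights"
      using le by (auto simp: boundary_weights_def V2_def)
    moreover have "weighted_sum v (x - s *\<^sub>R d) = weighted_sum v x"
      by (simp add: d(3) linear_diff[OF linear_weighted_sum] linear_scale[OF linear_weighted_sum])
    ultimately show ?thesis unfolding edges_def by (metis image_eqI)
  qed
  then show ?thesis by (auto simp: hull_eq_weighted_sum)
qed

lemma interior_edges: "interior (edges v) = {}" for v :: "complex ^ 3"
proof -
  have "closed (\<Union>p\<in>A. closed_segment (v $ fst p) (v $ snd p)) \<and>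
      interior (\<Union>p\<in>A. closed_segment (v $ fst p) (v $ snd p)) = {}" if "finite A" for A
    using that
    by induction (simp_all add: interior_closed_Un_empty_interior interior_closed_segment closed_Un)
  from this[of UNIV]
  have "interior (\<Union>p. closed_segment (v $ fst p) (v $ snd p)) = {}" by simp
  moreover have "edges v = (\<Union>p. closed_segment (v $ fst p) (v $ snd p))"
    unfolding edges_eq_segments by fastforce
  ultimately show ?thesis by simp
qed

lemma open_triangle_degenerate: "degenerate v \<Longrightarrow> open_triangle v = {}"
  using interior_mono[OF degenerate_hull_subset_edges, of v] interior_edges[of v]
  by (simp add: open_triangle_def)

lemma open_triangle_nondegenerate:
  assumes "\<not> degenerate v"
  shows "open_triangle v = weighted_sum v ` V2_star"
proof -
  \<comment> \<open>Collinear vertices give an affine dependence: either two of them coincide, or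
    \<open>v $ 2\<close> is an affine combination of the other two.\<close>
  have noncol: "\<not> collinear {v $ 1, v $ 2, v $ 3}"
  proof
    assume "collinear {v $ 1, v $ 2, v $ 3}"
    then consider "v $ 1 = v $ 3" | u where "v $ 2 = u *\<^sub>R v $ 1 + (1 - u) *\<^sub>R v $ 3"
      by (auto simp: collinear_3_expand)
    then show False
    proof cases
      case 1
      then have "degenerate v" unfolding degenerate_def
        by (intro exI[of _ "vector [1, 0, -1]"]) (simp add: weighted_sum_def sum_3 vec_eq_iff forall_3)
      then show False using assms by simp
    next
      case 2
      then have "degenerate v" unfolding degenerate_def
        by (intro exI[of _ "vector [u, -1, 1 - u]"]) (simp add: weighted_sum_def sum_3 vec_eq_iff forall_3)
      then show False using assms by simp
    qed
  qed
  have r: "range (($) v) = {v $ 1, v $ 2, v $ 3}" unfolding UNIV_3 by auto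
  have "open_triangle v = {z. \<exists>x y w. 0 < x \<and> 0 < y \<and> 0 < w \<and> x + y + w = 1 \<and>
      x *\<^sub>R v $ 1 + y *\<^sub>R v $ 2 + w *\<^sub>R v $ 3 = z}"
    unfolding open_triangle_def r using noncol by (rule interior_convex_hull_3_minimal) simp
  also have "\<dots> = weighted_sum v ` V2_star"
  proof (intro equalityI subsetI)
    fix z assume "z \<in> {z. \<exists>x y w. 0 < x \<and> 0 < y \<and> 0 < w \<and> x + y + w = 1 \<and>
      x *\<^sub>R v $ 1 + y *\<^sub>R v $ 2 + w *\<^sub>R v $ 3 = z}"
    then obtain x y w where *: "0 < x" "0 < y" "0 < w" "x + y + w = 1"
      "x *\<^sub>R v $ 1 + y *\<^sub>R v $ 2 + w *\<^sub>R v $ 3 = z" by blast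
    then have "vector [x, y, w] \<in> V2_star" "weighted_sum v (vector [x, y, w]) = z"
      by (auto simp: V2_star_def V2_def forall_3 sum_3 weighted_sum_def)
    then show "z \<in> weighted_sum v ` V2_star" by blast
  next
    fix z assume "z \<in> weighted_sum v ` V2_star"
    then obtain x where "x \<in> V2_star" "z = weighted_sum v x" by blast
    then have "0 < x $ 1 \<and> 0 < x $ 2 \<and> 0 < x $ 3 \<and> x $ 1 + x $ 2 + x $ 3 = 1 \<and>
      x $ 1 *\<^sub>R v $ 1 + x $ 2 *\<^sub>R v $ 2 + x $ 3 *\<^sub>R v $ 3 = z"
      by (simp add: V2_star_def V2_def sum_3 weighted_sum_def)
    then show "z \<in> {z. \<exists>x y w. 0 < x \<and> 0 < y \<and> 0 < w \<and> x + y + w = 1 \<and>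
      x *\<^sub>R v $ 1 + y *\<^sub>R v $ 2 + w *\<^sub>R v $ 3 = z}" by blast
  qed
  finally show ?thesis .
qed

lemma open_triangle_subset_hull: "open_triangle v \<subseteq> convex hull (range (($) v))"
  by (simp add: open_triangle_def interior_subset)

lemma open_triangle_empty_iff: "open_triangle v = {} \<longleftrightarrow> degenerate v"
proof
  assume *: "open_triangle v = {}"
  have "(1/3) *\<^sub>R vec 1 \<in> V2_star" by (auto simp: V2_star_def V2_def)
  then show "degenerate v" using * open_triangle_nondegenerate[of v] by fastforce
qed (rule open_triangle_degenerate)

lemma open_triangle_Int_edges: "open_triangle v \<inter> edges v = {}"
proof (cases "degenerate v")
  case False
  have "x = y" if "x \<in> V2_star" "y \<in> boundary_weights" "weighted_sum v x = weighted_sum v y" for x y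
    using barycentric_unique[OF False] that by (auto simp: V2_star_def boundary_weights_def)
  moreover have "V2_star \<inter> boundary_weights = {}"
    unfolding V2_star_def boundary_weights_def by (smt (verit) disjoint_iff mem_Collect_eq)
  ultimately show ?thesis
    unfolding open_triangle_nondegenerate[OF False] edges_def by blast
qed (simp add: open_triangle_degenerate)

lemma hull_eq_open_triangle_edges: "convex hull (range (($) v)) = open_triangle v \<union> edges v"
proof (cases "degenerate v")
  case True
  then show ?thesis
    using degenerate_hull_subset_edges edges_subset_hull open_triangle_degenerate by blast
next
  case False
  then show ?thesis
    by (simp add: hull_eq_weighted_sum open_triangle_nondegenerate edges_def V2_eq image_Un)
qed

lemma ABC_nondegenerate: "\<not> degenerate ABC"
proof
  assume "degenerate ABC"
  then obtain d where d: "d \<noteq> 0" "(\<Sum>i\<in>UNIV. d $ i) = 0" "weighted_sum ABC d = 0"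
    by (auto simp: degenerate_def)
  have "Im (weighted_sum ABC d) = d $ 3 * (sqrt 3 / 2)" "Re (weighted_sum ABC d) = d $ 2 + d $ 3 / 2"
    by (simp_all add: weighted_sum_def sum_3 ABC_def sin_60 cos_60)
  then have "d $ 3 = 0" "d $ 2 = 0" using d(3) by auto
  then have "d = 0" using d(2) by (simp add: vec_eq_iff forall_3 sum_3)
  then show False using d(1) by simp
qed

section \<open>Subdividing a triangle\<close>

definition subdivide :: "'a::real_vector ^ 3 \<Rightarrow> 3 \<Rightarrow> real ^ 3 \<Rightarrow> 'a ^ 3" where
  "subdivide v i P = replace_entry v i (weighted_sum v P)"

text \<open>Change of coordinates: weights with respect to the \<open>i\<close>-th part of the
  subdivision at \<open>P\<close> become weights with respect to the whole triangle.\<close>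

definition subdivide_weights :: "3 \<Rightarrow> real ^ 3 \<Rightarrow> real ^ 3 \<Rightarrow> real ^ 3" where
  "subdivide_weights i P x = (\<chi> j. x $ i * P $ j + (if j = i then 0 else x $ j))"

lemma subdivide_nth: "subdivide v i P $ j = (if j = i then weighted_sum v P else v $ j)"
  by (simp add: subdivide_def replace_entry_def)

lemma weighted_sum_subdivide:
  "weighted_sum (subdivide v i P) x = weighted_sum v (subdivide_weights i P x)"
  using exhaust_3[of i]
  by (auto simp: weighted_sum_def subdivide_def replace_entry_def subdivide_weights_def sum_3 algebra_simps)

lemma sum_subdivide_weights:
  "(\<Sum>j\<in>UNIV. subdivide_weights i P x $ j) = (\<Sum>j\<in>UNIV. x $ j) + x $ i * ((\<Sum>j\<in>UNIV. P $ j) - 1)"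
  using exhaust_3[of i] by (auto simp: subdivide_weights_def sum_3 algebra_simps)

lemma subdivide_weights_V2:
  assumes "P \<in> V2" "x \<in> V2"
  shows "subdivide_weights i P x \<in> V2"
  using assms sum_subdivide_weights[of i P x] by (auto simp: V2_def subdivide_weights_def)

lemma hull_subdivide_subset:
  assumes "P \<in> V2"
  shows "convex hull (range (($) (subdivide v i P))) \<subseteq> convex hull (range (($) v))"
  using subdivide_weights_V2[OF assms]
  by (auto simp: hull_eq_weighted_sum weighted_sum_subdivide)

lemma open_triangle_subdivide_subset:
  assumes "P \<in> V2"
  shows "open_triangle (subdivide v i P) \<subseteq> open_triangle v"
  unfolding open_triangle_def by (intro interior_mono hull_subdivide_subset assms)

text \<open>The new vertex lies on the side opposite to vertex \<open>i\<close>. In the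
  \<open>i\<close>-th part it is therefore represented both by \<open>P\<close> and by the unit
  vector at \<open>i\<close>, and their difference is a dependence.\<close>

lemma degenerate_subdivide_0:
  assumes "P \<in> V2" "P $ i = 0"
  shows "degenerate (subdivide v i P)"
proof -
  let ?d = "P - axis i 1"
  have "?d $ i \<noteq> 0" using assms by (simp add: axis_def)
  then have "?d \<noteq> 0" by auto
  moreover have "(\<Sum>j\<in>UNIV. ?d $ j) = 0"
    using assms axis_V2[of i] by (simp add: V2_def sum_subtractf)
  moreover have "subdivide_weights i P ?d = 0"
    using assms by (simp add: vec_eq_iff subdivide_weights_def axis_def)
  then have "weighted_sum (subdivide v i P) ?d = 0"
    by (simp add: weighted_sum_subdivide linear_0[OF linear_weighted_sum])
  ultimately show ?thesis unfolding degenerate_def by blast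
qed

lemma degenerate_subdivide:
  fixes v :: "complex ^ 3"
  assumes "P \<in> V2" "degenerate v"
  shows "degenerate (subdivide v i P)"
  using open_triangle_subdivide_subset[OF assms(1), of v i] assms(2)
  by (simp flip: open_triangle_empty_iff)

lemma nondegenerate_subdivide:
  assumes "\<not> degenerate v" "P \<in> V2_star"
  shows "\<not> degenerate (subdivide v i P)"
proof
  have P: "P $ i > 0" "(\<Sum>j\<in>UNIV. P $ j) = 1" using assms(2) by (auto simp: V2_star_def V2_def)
  assume "degenerate (subdivide v i P)"
  then obtain d where d: "d \<noteq> 0" "(\<Sum>i\<in>UNIV. d $ i) = 0" "weighted_sum (subdivide v i P) d = 0"
    by (auto simp: degenerate_def)
  have "subdivide_weights i P d = 0"
    using assms(1) d sum_subdivide_weights[of i P d] P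
    unfolding degenerate_def weighted_sum_subdivide by auto
  then have *: "d $ i * P $ j + (if j = i then 0 else d $ j) = 0" for j
    by (simp add: vec_eq_iff subdivide_weights_def)
  have "d $ i = 0" using *[of i] P by simp
  then have "d $ j = 0" for j using *[of j] by (cases "j = i") auto
  then show False using d(1) by (simp add: vec_eq_iff)
qed

text \<open>Compare the weights of a point with those of \<open>P\<close>: in the open part
  \<open>i\<close> the ratio is strictly smaller at \<open>i\<close> than at \<open>j\<close>, in
  the closed part \<open>j\<close> it is at most as large at \<open>j\<close> as at
  \<open>i\<close>. Since \<open>P $ j\<close> may vanish, the comparison is made with products
  instead of quotients.\<close>

lemma open_triangle_Int_hull_sibling:
  fixes v :: "complex ^ 3"
  assumes "P \<in> V2" "i \<noteq> j"
  shows "open_triangle (subdivide v i P) \<inter> convex hull (range (($) (subdivide v j P))) = {}"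
proof (cases "degenerate (subdivide v i P)")
  case False
  then have v: "\<not> degenerate v" and "P $ i \<noteq> 0"
    using degenerate_subdivide degenerate_subdivide_0 assms(1) by blast+
  show ?thesis
  proof (rule ccontr)
    assume "\<not> ?thesis"
    then obtain x y where x: "x \<in> V2_star" and y: "y \<in> V2"
      and eq: "weighted_sum v (subdivide_weights i P x) = weighted_sum v (subdivide_weights j P y)"
      by (auto simp: open_triangle_nondegenerate[OF False] hull_eq_weighted_sum weighted_sum_subdivide)
    have "subdivide_weights i P x = subdivide_weights j P y"
      using barycentric_unique[OF v _ _ eq] subdivide_weights_V2 x y assms(1) V2_star_subset by blast
    then have "subdivide_weights i P x $ k = subdivide_weights j P y $ k" for k by simp
    from this[of i] this[of j]
    have "x $ i * P $ i = y $ j * P $ i + y $ i" "x $ i * P $ j + x $ j = y $ j * P $ j"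
      using assms(2) by (simp_all add: subdivide_weights_def)
    moreover have P: "P $ i > 0" "P $ j \<ge> 0" and "x $ j > 0" "y $ i \<ge> 0"
      using \<open>P $ i \<noteq> 0\<close> V2_D(1)[OF assms(1), of i] V2_D(1)[OF assms(1), of j]
        V2_star_D(1)[OF x, of j] V2_D(1)[OF y, of i] by simp_all
    ultimately have "y $ j * P $ i \<le> x $ i * P $ i" "x $ i * P $ j < y $ j * P $ j" by auto
    moreover from this(1) P(1) have "y $ j \<le> x $ i" by simp
    ultimately show False using mult_right_mono[OF _ P(2), of "y $ j" "x $ i"] by simp
  qed
qed (simp add: open_triangle_degenerate)

text \<open>The smallest ratio of a weight of the point to the corresponding positive weight of
  \<open>P\<close> tells which part contains the point.\<close>

lemma hull_subset_subdivide:
  fixes v :: "'a::real_vector ^ 3"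
  assumes "P \<in> V2"
  shows "convex hull (range (($) v)) \<subseteq> (\<Union>i. convex hull (range (($) (subdivide v i P))))"
proof
  fix z assume "z \<in> convex hull (range (($) v))"
  then obtain x where x: "x \<in> V2" "z = weighted_sum v x" by (auto simp: hull_eq_weighted_sum)
  have P: "\<And>i. P $ i \<ge> 0" "(\<Sum>i\<in>UNIV. P $ i) = 1" using assms by (auto simp: V2_def)
  have "\<exists>i. P $ i > 0"
  proof (rule ccontr)
    assume "\<nexists>i. P $ i > 0"
    then have "P $ i = 0" for i using P(1)[of i] by (metis less_le)
    then show False using P(2) by simp
  qed
  then have pos: "{i. P $ i > 0} \<noteq> {}" by simp
  define s where "s = Min ((\<lambda>i. x $ i / P $ i) ` {i. P $ i > 0})"
  have "s \<in> (\<lambda>i. x $ i / P $ i) ` {i. P $ i > 0}"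
    unfolding s_def using pos by (intro Min_in) auto
  then obtain i where i: "P $ i > 0" "s = x $ i / P $ i" by auto
  have s0: "s \<ge> 0" using i x by (simp add: V2_def)
  have le: "s * P $ j \<le> x $ j" for j
  proof (cases "P $ j > 0")
    case True
    then have "s \<le> x $ j / P $ j" unfolding s_def by (intro Min_le) auto
    then show ?thesis using True by (simp add: pos_le_divide_eq)
  next
    case False
    then have "P $ j = 0" using P(1)[of j] by simp
    then show ?thesis using x by (simp add: V2_def)
  qed
  \<comment> \<open>Inverse of the change of weights: the new vertex receives weight
    \<open>s\<close>, which accounts for the share \<open>s * P $ j\<close> of each other
    weight.\<close>
  define y where "y = (\<chi> j. if j = i then s else x $ j - s * P $ j)"
  have w: "subdivide_weights i P y = x"
    using i by (auto simp: vec_eq_iff subdivide_weights_def y_def)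
  have "(\<Sum>j\<in>UNIV. y $ j) = 1"
    using sum_subdivide_weights[of i P y] w x P by (simp add: V2_def)
  then have "y \<in> V2" using le s0 by (auto simp: V2_def y_def)
  then have "z \<in> convex hull (range (($) (subdivide v i P)))"
    using w x(2) by (auto simp: hull_eq_weighted_sum weighted_sum_subdivide)
  then show "z \<in> (\<Union>i. convex hull (range (($) (subdivide v i P))))" by blast
qed

section \<open>The drawing of a labelled tree\<close>

text \<open>The first letter is consumed first, so that inductions over the geometry follow this
  recursion; \<open>node_vertices_snoc\<close> is the rule that the labels obey. The vector space is
  arbitrary because both points of the plane and coordinate triples are produced in this
  way.\<close>

fun node_vertices :: "'a::real_vector ^ 3 \<Rightarrow> (3 list \<Rightarrow> real ^ 3) \<Rightarrow> 3 list \<Rightarrow> 'a ^ 3" where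
  "node_vertices v p [] = v"
| "node_vertices v p (i # u) = node_vertices (subdivide v i (p [])) (\<lambda>w. p (i # w)) u"

definition node_point :: "'a::real_vector ^ 3 \<Rightarrow> (3 list \<Rightarrow> real ^ 3) \<Rightarrow> 3 list \<Rightarrow> 'a" where
  "node_point v p u = weighted_sum (node_vertices v p u) (p u)"

text \<open>The perimeter of \<open>v\<close> is left out and added where needed: the perimeter of a
  part is already contained in that of its parent together with the segments at the parent's
  point.\<close>

definition drawing :: "'a::real_vector ^ 3 \<Rightarrow> 3 list set \<Rightarrow> (3 list \<Rightarrow> real ^ 3) \<Rightarrow> 'a set" where
  "drawing v t p = (\<Union>u\<in>internal_nodes t. \<Union>i. closed_segment (node_vertices v p u $ i) (node_point v p u))"

lemma node_vertices_snoc: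
  "node_vertices v p (u @ [i]) = subdivide (node_vertices v p u) i (p u)"
  by (induction u arbitrary: v p) simp_all

text \<open>Only points at proper prefixes of \<open>u\<close> enter, and these are internal nodes
  of any tree containing \<open>u\<close>. The values of the point function elsewhere may be
  arbitrary.\<close>

lemma node_vertices_cong:
  assumes "\<And>w i x. u = w @ i # x \<Longrightarrow> p w = q w"
  shows "node_vertices v p u = node_vertices v q u"
  using assms
proof (induction u arbitrary: v p q)
  case (Cons k u)
  have "p [] = q []" using Cons.prems[of "[]"] by simp
  moreover have "p (k # w) = q (k # w)" if "u = w @ j # x" for w j x
    using Cons.prems[of "k # w"] that by simp
  then have "node_vertices v' (\<lambda>w. p (k # w)) u = node_vertices v' (\<lambda>w. q (k # w)) u"
    for v' :: "'a ^ 3"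
    by (intro Cons.IH[where p = "\<lambda>w. p (k # w)" and q = "\<lambda>w. q (k # w)"])
  ultimately show ?case by simp
qed simp

lemma node_vertices_cong_tree:
  assumes "ternary_tree t" "u \<in> t" "\<forall>w\<in>internal_nodes t. p w = q w"
  shows "node_vertices v p u = node_vertices v q u"
  using prefix_internal[OF assms(1)] assms(2,3) by (intro node_vertices_cong) auto

lemma node_point_cong_tree:
  assumes "ternary_tree t" "u \<in> internal_nodes t" "\<forall>w\<in>internal_nodes t. p w = q w"
  shows "node_point v p u = node_point v q u"
proof -
  have "node_vertices v p u = node_vertices v q u"
    using assms internal_nodes_subset by (intro node_vertices_cong_tree[OF assms(1)]) blast+
  then show ?thesis using assms(2,3) by (simp add: node_point_def)
qed

lemma drawing_cong:
  assumes "ternary_tree t" "\<forall>w\<in>internal_nodes t. p w = q w"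
  shows "drawing v t p = drawing v t q"
proof -
  have "node_vertices v p u = node_vertices v q u" "node_point v p u = node_point v q u"
    if "u \<in> internal_nodes t" for u
    using node_vertices_cong_tree[OF assms(1) _ assms(2)] node_point_cong_tree[OF assms(1) that assms(2)]
      that internal_nodes_subset by blast+
  then show ?thesis unfolding drawing_def by (intro SUP_cong refl) presburger
qed

lemma drawing_singleton: "drawing v {[]} p = {}"
  by (simp add: drawing_def ternary_tree_singleton)

lemma node_point_Cons: "node_point v p (i # u) = node_point (subdivide v i (p [])) (\<lambda>w. p (i # w)) u"
  by (simp add: node_point_def)

lemma drawing_node:
  assumes "[] \<in> internal_nodes t"
  shows "drawing v t p = (\<Union>i. closed_segment (v $ i) (weighted_sum v (p [])))
    \<union> (\<Union>i. drawing (subdivide v i (p [])) (subtree i t) (\<lambda>w. p (i # w)))"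
proof -
  have "node_point v p [] = weighted_sum v (p [])" by (simp add: node_point_def)
  then show ?thesis
    unfolding drawing_def internal_nodes_decompose[OF assms]
    by (simp only: UN_insert UN_UN_flatten SUP_image comp_def node_vertices.simps node_point_Cons)
qed

lemma closed_drawing:
  fixes v :: "'a::euclidean_space ^ 3"
  assumes "ternary_tree t"
  shows "closed (drawing v t p)"
  unfolding drawing_def by (intro closed_UN ternary_tree_finite assms) auto

lemma segments_subset_edges_subdivide:
  assumes "i \<noteq> j"
  shows "closed_segment (v $ i) (weighted_sum v P) \<subseteq> edges (subdivide v j P)"
  unfolding edges_eq_segments using assms
  by (intro subsetI UN_I[of i UNIV] UN_I[of j UNIV]) (simp_all add: subdivide_nth)

lemma edges_subdivide_subset:
  "edges (subdivide v i P) \<subseteq> edges v \<union> (\<Union>j. closed_segment (v $ j) (weighted_sum v P))"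
    (is "_ \<subseteq> ?R")
proof -
  have "closed_segment (subdivide v i P $ j) (subdivide v i P $ k) \<subseteq> ?R" for j k
  proof -
    have "closed_segment (v $ j) (v $ k) \<subseteq> ?R" unfolding edges_eq_segments by blast
    moreover have "closed_segment (v $ j) (weighted_sum v P) \<subseteq> ?R" for j by blast
    moreover have "closed_segment (weighted_sum v P) (v $ j) \<subseteq> ?R" for j
      unfolding closed_segment_commute[of "weighted_sum v P"] by blast
    moreover from this have "weighted_sum v P \<in> ?R" by auto
    ultimately show ?thesis by (cases "j = i"; cases "k = i") (simp_all add: subdivide_nth)
  qed
  then show ?thesis unfolding edges_eq_segments[of "subdivide v i P"] by (intro UN_least)
qed

lemma drawing_subset_hull:
  assumes "ternary_tree t" "\<forall>u\<in>internal_nodes t. p u \<in> V2"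
  shows "drawing v t p \<subseteq> convex hull (range (($) v))"
  using assms
proof (induction t arbitrary: v p rule: ternary_tree_induct)
  case leaf
  then show ?case by (simp add: drawing_singleton)
next
  case (node t)
  have P: "p [] \<in> V2" using node by blast
  have "closed_segment (v $ i) (weighted_sum v (p [])) \<subseteq> convex hull (range (($) v))" for i
    using P by (intro closed_segment_subset) (simp_all add: hull_inc, simp add: hull_eq_weighted_sum)
  moreover have "drawing (subdivide v i (p [])) (subtree i t) (\<lambda>w. p (i # w)) \<subseteq> convex hull (range (($) v))" for i
    using node.IH[of i "\<lambda>w. p (i # w)" "subdivide v i (p [])"] node.prems hull_subdivide_subset[OF P, of v i]
    by (auto simp: internal_nodes_Cons)
  ultimately show ?case unfolding drawing_node[OF node(2)] by blast
qed

lemma open_triangle_node_subset: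
  assumes "ternary_tree t" "u \<in> t" "\<forall>u\<in>internal_nodes t. p u \<in> V2"
  shows "open_triangle (node_vertices v p u) \<subseteq> open_triangle v"
  using assms(2)
proof (induction u rule: rev_induct)
  case (snoc i u)
  have "p u \<in> V2" using prefix_internal[OF assms(1), of u i "[]"] snoc.prems assms(3) by simp
  then show ?case
    using snoc ternary_tree_prefix[OF assms(1)] open_triangle_subdivide_subset
    unfolding node_vertices_snoc by blast
qed simp

section \<open>Faces of a drawing\<close>

text \<open>The leaf triangle lies in one open part of the first subdivision, which is disjoint from
  the closed sibling parts; inside its own part induction applies. Every root segment is on the
  perimeter of some part and is covered by one of these two cases.\<close>

lemma leaf_triangles_disjoint_drawing:
  fixes v :: "complex ^ 3"
  assumes "ternary_tree t" "\<forall>u\<in>internal_nodes t. p u \<in> V2" "l \<in> leaves t"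
  shows "open_triangle (node_vertices v p l) \<inter> (edges v \<union> drawing v t p) = {}"
  using assms
proof (induction t arbitrary: v p l rule: ternary_tree_induct)
  case leaf
  then show ?case by (simp add: drawing_singleton ternary_tree_singleton open_triangle_Int_edges)
next
  case (node t)
  have P: "p [] \<in> V2" using node by blast
  obtain i u where l: "l = i # u" "u \<in> leaves (subtree i t)"
    using node.prems(2) unfolding leaves_decompose[OF node(2)] by blast
  let ?O = "open_triangle (node_vertices v p l)"
  let ?d = "\<lambda>j. drawing (subdivide v j (p [])) (subtree j t) (\<lambda>w. p (j # w))"
  have V2: "\<forall>w\<in>internal_nodes (subtree j t). p (j # w) \<in> V2" for j
    using node.prems(1) internal_nodes_Cons by blast
  have IH: "?O \<inter> (edges (subdivide v i (p [])) \<union> ?d i) = {}"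
    using node.IH[of i "\<lambda>w. p (i # w)" u "subdivide v i (p [])"] l V2 by simp
  have sub: "?O \<subseteq> open_triangle (subdivide v i (p []))"
    using open_triangle_node_subset[OF node(3)[of i], of u "\<lambda>w. p (i # w)" "subdivide v i (p [])"] V2 l leaves_subset
    by auto
  have sib: "?O \<inter> convex hull (range (($) (subdivide v j (p [])))) = {}" if "j \<noteq> i" for j
    using open_triangle_Int_hull_sibling[OF P, of i j v] sub that by blast
  have "?O \<inter> ?d j = {}" for j
    using IH sib[of j] drawing_subset_hull[OF node(3)[of j], of "\<lambda>w. p (j # w)"] V2
    by (cases "j = i") blast+
  moreover have "?O \<inter> closed_segment (v $ j) (weighted_sum v (p [])) = {}" for j
  proof -
    obtain k where "j \<noteq> k" by (metis other_indices)
    then have "closed_segment (v $ j) (weighted_sum v (p [])) \<subseteq> edges (subdivide v k (p []))"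
      by (rule segments_subset_edges_subdivide)
    then show ?thesis using IH sib[of k] edges_subset_hull[of "subdivide v k (p [])"] by (cases "k = i") blast+
  qed
  moreover have "?O \<inter> edges v = {}"
    using sub open_triangle_subdivide_subset[OF P, of v i] open_triangle_Int_edges[of v] by blast
  ultimately show ?case unfolding drawing_node[OF node(2)] by blast
qed

lemma leaf_triangles_disjoint:
  fixes v :: "complex ^ 3"
  assumes "ternary_tree t" "\<forall>u\<in>internal_nodes t. p u \<in> V2"
    "l \<in> leaves t" "l' \<in> leaves t" "l \<noteq> l'"
  shows "open_triangle (node_vertices v p l) \<inter> open_triangle (node_vertices v p l') = {}"
  using assms
proof (induction t arbitrary: v p l l' rule: ternary_tree_induct)
  case leaf
  then show ?case by (simp add: ternary_tree_singleton)
next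
  case (node t)
  have P: "p [] \<in> V2" using node by blast
  have V2: "\<forall>w\<in>internal_nodes (subtree j t). p (j # w) \<in> V2" for j
    using node.prems(1) internal_nodes_Cons by blast
  obtain i u where l: "l = i # u" "u \<in> leaves (subtree i t)"
    using node.prems(2) unfolding leaves_decompose[OF node(2)] by blast
  obtain j w where l': "l' = j # w" "w \<in> leaves (subtree j t)"
    using node.prems(3) unfolding leaves_decompose[OF node(2)] by blast
  have sub: "open_triangle (node_vertices v p (k # x)) \<subseteq> open_triangle (subdivide v k (p []))"
    if "x \<in> leaves (subtree k t)" for k x
    using open_triangle_node_subset[OF node(3)[of k], of x "\<lambda>w. p (k # w)" "subdivide v k (p [])"]
      V2 leaves_subset that by auto
  show ?case
  proof (cases "i = j")
    case True
    then show ?thesis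
      using node.IH[of i "\<lambda>w. p (i # w)" u w "subdivide v i (p [])"] l l' V2 node.prems(4) by simp
  next
    case False
    then show ?thesis
      using open_triangle_Int_hull_sibling[OF P, of i j v] sub[OF l(2)] sub[OF l'(2)] l(1) l'(1)
        open_triangle_subset_hull[of "subdivide v j (p [])"] by blast
  qed
qed

text \<open>The three parts cover the triangle, and what lies on the perimeter of a part is on the
  outer perimeter or on a root segment.\<close>

lemma hull_covered:
  fixes v :: "complex ^ 3"
  assumes "ternary_tree t" "\<forall>u\<in>internal_nodes t. p u \<in> V2"
  shows "convex hull (range (($) v)) \<subseteq>
    edges v \<union> drawing v t p \<union> (\<Union>l\<in>leaves t. open_triangle (node_vertices v p l))"
  using assms
proof (induction t arbitrary: v p rule: ternary_tree_induct)
  case leaf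
  then show ?case by (auto simp: hull_eq_open_triangle_edges ternary_tree_singleton)
next
  case (node t)
  have P: "p [] \<in> V2" using node by blast
  let ?R = "edges v \<union> drawing v t p \<union> (\<Union>l\<in>leaves t. open_triangle (node_vertices v p l))"
  have "convex hull (range (($) (subdivide v i (p [])))) \<subseteq> ?R" for i
  proof -
    have set: "H \<subseteq> A \<union> D \<union> L"
      if "H \<subseteq> A' \<union> D' \<union> L'" "L' \<subseteq> L" "D' \<subseteq> D" "S \<subseteq> D" "A' \<subseteq> A \<union> S"
      for H A A' D D' L L' S :: "complex set"
      using that by blast
    show ?thesis
    proof (rule set)
      show "convex hull (range (($) (subdivide v i (p [])))) \<subseteq>
        edges (subdivide v i (p [])) \<union> drawing (subdivide v i (p [])) (subtree i t) (\<lambda>w. p (i # w)) \<union>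
        (\<Union>l\<in>leaves (subtree i t). open_triangle (node_vertices v p (i # l)))"
        using node.IH[of i "\<lambda>w. p (i # w)" "subdivide v i (p [])"] node.prems by (simp add: internal_nodes_Cons)
      show "(\<Union>l\<in>leaves (subtree i t). open_triangle (node_vertices v p (i # l)))
          \<subseteq> (\<Union>l\<in>leaves t. open_triangle (node_vertices v p l))"
        using leaves_Cons by blast
      show "drawing (subdivide v i (p [])) (subtree i t) (\<lambda>w. p (i # w)) \<subseteq> drawing v t p"
        "(\<Union>j. closed_segment (v $ j) (weighted_sum v (p []))) \<subseteq> drawing v t p"
        unfolding drawing_node[OF node(2)] by blast+
    qed (rule edges_subdivide_subset)
  qed
  then have "(\<Union>i. convex hull (range (($) (subdivide v i (p []))))) \<subseteq> ?R" by (intro UN_least)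
  then show ?case by (rule order_trans[OF hull_subset_subdivide[OF P, of v]])
qed

lemma open_triangle_open_connected: "open (open_triangle v)" "connected (open_triangle v)"
  by (simp_all add: open_triangle_def convex_connected convex_interior)

text \<open>With points on sides allowed, leaf triangles can be flat. Their interiors are empty and
  have to be discarded.\<close>

lemma faces_drawing:
  assumes "ternary_tree t" "\<forall>u\<in>internal_nodes t. p u \<in> V2"
  shows "faces (base_triangle \<union> drawing ABC t p) =
    (\<lambda>l. open_triangle (node_vertices ABC p l)) ` leaves t - {{}}"
proof -
  let ?O = "\<lambda>l. open_triangle (node_vertices ABC p l)"
  let ?m = "base_triangle \<union> drawing ABC t p"
  let ?H = "convex hull (range (($) ABC))"
  let ?A = "insert (- ?H) (?O ` leaves t - {{}})"
  have bH: "bounded ?H" by (intro bounded_convex_hull finite_imp_bounded) simp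
  have unb: "\<not> bounded (- ?H)" using bH by (intro cobounded_imp_unbounded) simp
  have cH: "closed ?H" by (intro compact_imp_closed compact_convex_hull finite_imp_compact) simp
  have O_sub: "?O l \<subseteq> ?H" if "l \<in> leaves t" for l
    using open_triangle_node_subset[OF assms(1), of l p ABC] that leaves_subset assms(2)
      open_triangle_subset_hull[of ABC] by blast
  have m_sub: "?m \<subseteq> ?H"
    using drawing_subset_hull[OF assms, of ABC] edges_subset_hull[of ABC] unfolding base_triangle_eq by blast
  \<comment> \<open>Open, connected, nonempty and pairwise disjoint sets that fill the complement
    are its components. The exterior of the hull is the only unbounded one among them.\<close>
  have comp: "components (- ?m) = ?A"
  proof (rule components_open_unique)
    show "\<Union>?A = - ?m"
    proof -
      have set: "- H \<union> U = - m" if "U \<inter> m = {}" "H \<subseteq> m \<union> U" "m \<subseteq> H" "U \<subseteq> H"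
        for H U m :: "complex set" using that by blast
      have "(\<Union>l\<in>leaves t. ?O l) \<inter> ?m = {}"
        using leaf_triangles_disjoint_drawing[OF assms, of _ ABC] unfolding base_triangle_eq by blast
      moreover have "(\<Union>l\<in>leaves t. ?O l) \<subseteq> ?H" using O_sub by (rule UN_least)
      ultimately have "- ?H \<union> (\<Union>l\<in>leaves t. ?O l) = - ?m"
        using hull_covered[OF assms, of ABC] m_sub unfolding base_triangle_eq by (intro set)
      moreover have "\<Union>?A = - ?H \<union> (\<Union>l\<in>leaves t. ?O l)" by (simp only: Union_insert) blast
      ultimately show ?thesis by (rule trans[rotated])
    qed
    show "pairwise disjnt ?A"
    proof -
      have "disjnt (?O l) (?O l')" if "l \<in> leaves t" "l' \<in> leaves t" "?O l \<noteq> ?O l'" for l l'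
        using leaf_triangles_disjoint[OF assms that(1,2), of ABC] that(3) unfolding disjnt_def by blast
      then have "pairwise disjnt (?O ` leaves t - {{}})" unfolding pairwise_def by blast
      moreover have "disjnt (- ?H) X \<and> disjnt X (- ?H)" if "X \<in> ?O ` leaves t - {{}}" for X
        using that O_sub unfolding disjnt_def by blast
      ultimately show ?thesis unfolding pairwise_insert by blast
    qed
    have "- ?H \<noteq> {}" using unb by (metis bounded_empty)
    moreover have "connected (- ?H)"
      using bH by (intro connected_complement_bounded_convex) auto
    moreover have "open (- ?H)" using cH by (simp add: open_Compl)
    ultimately show "open X \<and> connected X \<and> X \<noteq> {}" if "X \<in> ?A" for X
      using that open_triangle_open_connected by blast
  qed
  have bounded: "{f \<in> insert X B. bounded f} = B" if "\<not> bounded X" "\<And>f. f \<in> B \<Longrightarrow> bounded f"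
    for X :: "complex set" and B using that by auto
  show ?thesis unfolding faces_def comp
  proof (rule bounded[OF unb])
    show "bounded f" if "f \<in> ?O ` leaves t - {{}}" for f
      using that bounded_subset[OF bH O_sub] by blast
  qed
qed

lemma node_vertices_nondegenerate:
  assumes "ternary_tree t" "u \<in> t" "\<forall>u\<in>internal_nodes t. p u \<in> V2_star" "\<not> degenerate v"
  shows "\<not> degenerate (node_vertices v p u)"
  using assms(2)
proof (induction u rule: rev_induct)
  case (snoc i u)
  have "p u \<in> V2_star" using prefix_internal[OF assms(1), of u i "[]"] snoc.prems assms(3) by simp
  then show ?case
    using snoc ternary_tree_prefix[OF assms(1)] nondegenerate_subdivide
    unfolding node_vertices_snoc by blast
qed (simp add: assms)

text \<open>Positive weights keep all leaf triangles nondegenerate, and disjoint nonempty sets are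
  distinct.\<close>

lemma faces_drawing_bij:
  assumes "ternary_tree t" "\<forall>u\<in>internal_nodes t. p u \<in> V2_star"
  shows "bij_betw (\<lambda>l. open_triangle (node_vertices ABC p l)) (leaves t)
    (faces (base_triangle \<union> drawing ABC t p))"
proof -
  let ?O = "\<lambda>l. open_triangle (node_vertices ABC p l)"
  have ne: "?O l \<noteq> {}" if "l \<in> leaves t" for l
    using node_vertices_nondegenerate[OF assms(1) _ assms(2) ABC_nondegenerate] that leaves_subset
    by (auto simp: open_triangle_empty_iff)
  have V2: "\<forall>u\<in>internal_nodes t. p u \<in> V2" using assms(2) V2_star_subset by blast
  have "inj_on ?O (leaves t)"
    using leaf_triangles_disjoint[OF assms(1) V2, of _ _ ABC] ne by (intro inj_onI) (metis inf.idem)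
  then show ?thesis
    using ne unfolding bij_betw_def faces_drawing[OF assms(1) V2] by auto
qed

text \<open>A vanishing coordinate makes a leaf triangle degenerate, so a face is lost.\<close>

lemma V2_star_of_card_faces:
  assumes "ternary_tree t" "\<forall>u\<in>internal_nodes t. p u \<in> V2"
    "card (faces (base_triangle \<union> drawing ABC t p)) \<ge> card (leaves t)" "u \<in> internal_nodes t"
  shows "p u \<in> V2_star"
proof (rule ccontr)
  let ?O = "\<lambda>l. open_triangle (node_vertices ABC p l)"
  assume "p u \<notin> V2_star"
  then obtain i where i: "p u $ i = 0"
    using assms(2,4) by (auto simp: V2_star_def V2_def less_le)
  have "u @ [i] \<in> t" using assms(4) by (auto simp: internal_nodes_def)
  then obtain w where w: "(u @ [i]) @ w \<in> leaves t" using leaf_below[OF assms(1)] by blast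
  let ?l = "u @ i # w"
  have ui: "degenerate (node_vertices ABC p (u @ [i]))"
    unfolding node_vertices_snoc using degenerate_subdivide_0[OF _ i] assms(2,4) by blast
  have l: "?l \<in> leaves t" using w by simp
  \<comment> \<open>Flatness is inherited by all further subdivisions, so the flat child has a flat
    leaf below it.\<close>
  have "degenerate (node_vertices ABC p ((u @ [i]) @ x))" if "(u @ [i]) @ x \<in> t" for x
    using that
  proof (induction x rule: rev_induct)
    case Nil
    then show ?case using ui by simp
  next
    case (snoc j x)
    have "p ((u @ [i]) @ x) \<in> V2"
      using prefix_internal[OF assms(1), of "(u @ [i]) @ x" j "[]"] snoc.prems assms(2) by simp
    then show ?case
      using snoc ternary_tree_prefix[OF assms(1), of "(u @ [i]) @ x" "[j]"] degenerate_subdivide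
      unfolding append_assoc[symmetric] node_vertices_snoc by blast
  qed
  from this[of w] have "?O ?l = {}"
    using l leaves_subset[of t] by (auto simp: open_triangle_empty_iff)
  then have "faces (base_triangle \<union> drawing ABC t p) \<subseteq> ?O ` (leaves t - {?l})"
    unfolding faces_drawing[OF assms(1,2)] by blast
  then have "card (faces (base_triangle \<union> drawing ABC t p)) \<le> card (leaves t - {?l})"
    using ternary_tree_finite(2)[OF assms(1)]
    by (meson card_image_le card_mono finite_Diff finite_imageI order_trans)
  also have "\<dots> < card (leaves t)"
    using l ternary_tree_finite(2)[OF assms(1)] by (intro card_Diff1_less)
  finally show False using assms(3) by simp
qed

section \<open>A drawing determines its tree\<close>

lemma weighted_sum_in_open_triangle:
  assumes "\<not> degenerate v" "P \<in> V2_star"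
  shows "weighted_sum v P \<in> open_triangle v"
  using assms by (simp add: open_triangle_nondegenerate)

lemma vertex_in_edges: "v $ i \<in> edges v"
  unfolding edges_eq_segments by auto

text \<open>Positive weights put each new point strictly inside its triangle. By convexity the
  segment from it to a corner stays inside except possibly at that corner.\<close>

lemma drawing_subset_open_triangle:
  fixes v :: "complex ^ 3"
  assumes "ternary_tree t" "\<forall>u\<in>internal_nodes t. p u \<in> V2_star" "\<not> degenerate v"
  shows "drawing v t p \<subseteq> open_triangle v \<union> range (($) v)"
  using assms
proof (induction t arbitrary: v p rule: ternary_tree_induct)
  case leaf
  then show ?case by (simp add: drawing_singleton)
next
  case (node t)
  have P: "p [] \<in> V2_star" using node by blast
  let ?M = "weighted_sum v (p [])"
  have M: "?M \<in> open_triangle v" by (rule weighted_sum_in_open_triangle[OF node.prems(2) P])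
  have "closed_segment (v $ i) ?M \<subseteq> open_triangle v \<union> range (($) v)" for i
  proof -
    have "open_segment ?M (v $ i) \<subseteq> open_triangle v"
      unfolding open_triangle_def using M
      by (intro in_interior_closure_convex_segment convex_convex_hull)
        (auto simp: open_triangle_def intro: hull_inc closure_subset[THEN subsetD])
    then show ?thesis using M by (auto simp: closed_segment_eq_open open_segment_commute)
  qed
  moreover have "drawing (subdivide v i (p [])) (subtree i t) (\<lambda>w. p (i # w))
      \<subseteq> open_triangle v \<union> range (($) v)" for i
  proof -
    have "drawing (subdivide v i (p [])) (subtree i t) (\<lambda>w. p (i # w))
        \<subseteq> open_triangle (subdivide v i (p [])) \<union> range (($) (subdivide v i (p [])))"
      using node.prems nondegenerate_subdivide[OF node.prems(2) P]
      by (intro node.IH) (auto simp: internal_nodes_Cons)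
    moreover have "range (($) (subdivide v i (p []))) \<subseteq> open_triangle v \<union> range (($) v)"
      using M by (auto simp: subdivide_nth)
    ultimately show ?thesis
      using open_triangle_subdivide_subset[of "p []" v i] P V2_star_subset by blast
  qed
  ultimately show ?case unfolding drawing_node[OF node(2)] by blast
qed

text \<open>The segment ends at a point \<open>Q\<close> strictly between two vertices on the side
  opposite to vertex \<open>i\<close>. Its open part avoids the perimeter and would have to be
  drawn; the drawing is closed and would then contain \<open>Q\<close>, although it meets the
  perimeter only in vertices.\<close>

lemma segment_not_in_drawing:
  fixes v :: "complex ^ 3"
  assumes "ternary_tree t" "\<forall>u\<in>internal_nodes t. p u \<in> V2_star" "\<not> degenerate v"
    and x: "x \<in> V2" "x $ i = 0" "\<And>j. j \<noteq> i \<Longrightarrow> x $ j > 0"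
  shows "\<not> closed_segment (v $ i) (weighted_sum v x) \<subseteq> edges v \<union> drawing v t p"
proof
  let ?Q = "weighted_sum v x"
  assume sub: "closed_segment (v $ i) ?Q \<subseteq> edges v \<union> drawing v t p"
  have axis: "x = axis l 1" if "?Q = v $ l" for l
    using barycentric_unique[OF assms(3) x(1) axis_V2[of l]] that by (simp add: weighted_sum_axis)
  obtain j k where jk: "i \<noteq> j" "j \<noteq> k" "i \<noteq> k" using other_indices by metis
  have nvert: "?Q \<noteq> v $ l" for l
  proof
    assume "?Q = v $ l"
    then have "x $ j = axis l 1 $ j" "x $ k = axis l 1 $ k" using axis by auto
    then show False using x(3)[of j] x(3)[of k] jk by (auto simp: axis_def split: if_splits)
  qed
  have "open_segment (v $ i) ?Q \<subseteq> open_triangle v"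
  proof
    fix z assume "z \<in> open_segment (v $ i) ?Q"
    then obtain u where u: "0 < u" "u < 1" "z = (1 - u) *\<^sub>R v $ i + u *\<^sub>R ?Q"
      by (auto simp: in_segment)
    let ?y = "(1 - u) *\<^sub>R axis i 1 + u *\<^sub>R x"
    have "?y \<in> V2" using convexD_alt[OF convex_V2 axis_V2 x(1)] u by simp
    moreover have "?y $ l > 0" for l
      using u x(2) x(3)[of l] by (cases "l = i") (auto simp: axis_def)
    ultimately have "?y \<in> V2_star" by (simp add: V2_star_def)
    moreover have "z = weighted_sum v ?y"
      by (simp add: u linear_add[OF linear_weighted_sum] linear_scale[OF linear_weighted_sum] weighted_sum_axis)
    ultimately show "z \<in> open_triangle v" using weighted_sum_in_open_triangle[OF assms(3)] by simp
  qed
  then have "open_segment (v $ i) ?Q \<subseteq> drawing v t p"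
    using sub open_triangle_Int_edges[of v] segment_open_subset_closed by blast
  then have "closure (open_segment (v $ i) ?Q) \<subseteq> drawing v t p"
    using closed_drawing[OF assms(1)] by (rule closure_minimal)
  then have "?Q \<in> drawing v t p" using nvert[of i] ends_in_segment(2) by (auto simp: closure_open_segment)
  moreover have "?Q \<in> edges v" using x(1,2) unfolding edges_def boundary_weights_def by blast
  then have "?Q \<notin> open_triangle v" using open_triangle_Int_edges[of v] by blast
  ultimately show False
    using drawing_subset_open_triangle[OF assms(1-3)] nvert by blast
qed

text \<open>Neither the root segments nor anything drawn in a sibling part enters the interior of
  part \<open>j\<close>. Hence the drawing of a subtree can be recovered from the whole set once the
  root point is known, which is the induction step for injectivity.\<close>

lemma drawing_Int_child:
  fixes v :: "complex ^ 3"
  assumes "ternary_tree t" "[] \<in> internal_nodes t" "\<forall>u\<in>internal_nodes t. p u \<in> V2"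
  shows "(edges v \<union> drawing v t p) \<inter> convex hull (range (($) (subdivide v j (p [])))) =
    edges (subdivide v j (p [])) \<union> drawing (subdivide v j (p [])) (subtree j t) (\<lambda>w. p (j # w))"
    (is "(_ \<union> ?D) \<inter> ?H j = ?E j \<union> ?d j")
proof
  have P: "p [] \<in> V2" using assms by blast
  have dH: "?d i \<subseteq> ?H i" for i
    using assms(3) by (intro drawing_subset_hull ternary_tree_subtree assms) (auto simp: internal_nodes_Cons)
  have EH: "?E i \<subseteq> ?H i" for i by (rule edges_subset_hull)
  have segs: "(\<Union>i. closed_segment (v $ i) (weighted_sum v (p []))) \<subseteq> ?D" and dD: "?d j \<subseteq> ?D"
    unfolding drawing_node[OF assms(2)] by blast+
  have "?E j \<subseteq> edges v \<union> ?D"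
    using edges_subdivide_subset[of v j "p []"] segs by (meson Un_mono order_refl order_trans)
  then show "?E j \<union> ?d j \<subseteq> (edges v \<union> ?D) \<inter> ?H j"
    using dD dH[of j] EH[of j] by (meson Int_greatest Un_least le_supI2)
  show "(edges v \<union> ?D) \<inter> ?H j \<subseteq> ?E j \<union> ?d j"
  proof
    fix z assume z: "z \<in> (edges v \<union> ?D) \<inter> ?H j"
    show "z \<in> ?E j \<union> ?d j"
    proof (rule ccontr)
      assume nz: "z \<notin> ?E j \<union> ?d j"
      then have zO: "z \<in> open_triangle (subdivide v j (p []))"
        using z hull_eq_open_triangle_edges[of "subdivide v j (p [])"] by simp
      then have "z \<notin> ?H i" if "i \<noteq> j" for i
        using open_triangle_Int_hull_sibling[OF P that[symmetric], of v] by blast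
      then have no: "z \<notin> ?E i" "z \<notin> ?d i" for i
        using EH[of i] dH[of i] nz by (cases "i = j"; blast)+
      have "z \<notin> closed_segment (v $ i) (weighted_sum v (p []))" for i
      proof -
        obtain k where "i \<noteq> k" by (metis other_indices)
        then show ?thesis using segments_subset_edges_subdivide[of i k v "p []"] no(1)[of k] by blast
      qed
      moreover have "z \<notin> edges v"
        using zO open_triangle_subdivide_subset[OF P, of v j] open_triangle_Int_edges[of v] by blast
      ultimately show False using z no(2) unfolding drawing_node[OF assms(2)] by simp
    qed
  qed
qed

text \<open>If \<open>P'\<close> lies in the \<open>i\<close>-th part of the subdivision at \<open>P\<close>, then the segment from the \<open>i\<close>-th
  vertex to \<open>P'\<close> enters it through one of its two inner sides, after crossing an adjacent part from
  a vertex to the opposite side.\<close>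

lemma root_segment_crosses:
  fixes v :: "complex ^ 3"
  assumes "ternary_tree t" "[] \<in> internal_nodes t" "\<forall>u\<in>internal_nodes t. p u \<in> V2_star" "\<not> degenerate v"
    and P': "P' \<in> V2_star" and ijk: "i \<noteq> j" "j \<noteq> k" "i \<noteq> k"
    and ratios: "P' $ i * p [] $ j \<le> P' $ j * p [] $ i" "P' $ j * p [] $ k < P' $ k * p [] $ j"
  shows "\<not> closed_segment (v $ i) (weighted_sum v P') \<subseteq> edges v \<union> drawing v t p"
proof
  let ?P = "p []"
  let ?w = "subdivide v j ?P"
  assume sub: "closed_segment (v $ i) (weighted_sum v P') \<subseteq> edges v \<union> drawing v t p"
  have P: "?P \<in> V2_star" using assms(2,3) by blast
  have pos: "?P $ l > 0" "P' $ l > 0" for l using P P' V2_star_D by blast+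
  have V2: "\<forall>u\<in>internal_nodes t. p u \<in> V2" using assms(3) V2_star_subset by blast
  \<comment> \<open>At parameter \<open>s = 1 / (1 + D)\<close> of the segment from vertex
    \<open>i\<close> to \<open>P'\<close>, the ratios to the weights of \<open>P\<close> at
    \<open>i\<close> and at \<open>j\<close> are equal. The point there lies on the common side of
    the parts \<open>i\<close> and \<open>j\<close>. Equality in the first hypothesis on ratios
    means \<open>D = 0\<close> and \<open>s = 1\<close>: then \<open>P'\<close> itself is on that
    side.\<close>
  define D where "D = P' $ j * ?P $ i / ?P $ j - P' $ i"
  have D: "D \<ge> 0" using ratios(1) pos[of j] by (simp add: D_def pos_le_divide_eq)
  define s where "s = 1 / (1 + D)"
  have s: "0 < s" "s \<le> 1" using D by (simp_all add: s_def)
  \<comment> \<open>Weights of the crossing point within part \<open>j\<close>: zero at vertex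
    \<open>i\<close>, positive at the new vertex and at vertex \<open>k\<close>.\<close>
  define x where "x = (\<chi> l. if l = i then 0 else if l = j then s * P' $ j / ?P $ j
    else s * P' $ k - s * P' $ j / ?P $ j * ?P $ k)"
  define y where "y = (1 - s) *\<^sub>R axis i 1 + s *\<^sub>R P'"
  have xi: "x $ i = 0" and xj: "x $ j = s * P' $ j / ?P $ j"
    and xk: "x $ k = s * P' $ k - s * P' $ j / ?P $ j * ?P $ k"
    using ijk by (simp_all add: x_def)
  have xj0: "x $ j > 0" using s pos by (simp add: xj)
  have "P' $ j / ?P $ j * ?P $ k < P' $ k" using ratios(2) pos[of j] by (simp add: pos_divide_less_eq)
  then have "s * (P' $ j / ?P $ j * ?P $ k) < s * P' $ k" using s(1) by (rule mult_strict_left_mono)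
  then have xk0: "x $ k > 0" by (simp add: xk mult.assoc)
  have yV: "y \<in> V2" unfolding y_def
    using P' V2_star_subset s by (intro convexD_alt[OF convex_V2 axis_V2]) auto
  have "subdivide_weights j ?P x $ l = y $ l" for l
  proof -
    have "s * (1 + D) = 1" using D by (simp add: s_def)
    then have "s * P' $ j / ?P $ j * ?P $ i = 1 - s + s * P' $ i"
      by (simp add: D_def algebra_simps)
    then show ?thesis using distinct_indices[OF ijk, of l] ijk pos[of j]
      by (auto simp: subdivide_weights_def y_def axis_def xi xj xk)
  qed
  then have xy: "subdivide_weights j ?P x = y" by (simp add: vec_eq_iff)
  have "(\<Sum>l\<in>UNIV. x $ l) = 1"
    using sum_subdivide_weights[of j ?P x] xy yV P by (simp add: V2_D V2_star_D)
  then have xV: "x \<in> V2"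
    using xi xj0 xk0 distinct_indices[OF ijk] by (auto simp: V2_def) (metis less_imp_le order_refl)
  have Q: "weighted_sum ?w x = (1 - s) *\<^sub>R v $ i + s *\<^sub>R weighted_sum v P'"
    by (simp add: weighted_sum_subdivide xy y_def linear_add[OF linear_weighted_sum]
        linear_scale[OF linear_weighted_sum] weighted_sum_axis)
  have wi: "?w $ i = v $ i" using ijk by (simp add: subdivide_nth)
  have "weighted_sum ?w x \<in> closed_segment (v $ i) (weighted_sum v P')"
    unfolding Q in_segment using s by (intro exI[of _ s]) simp
  then have "closed_segment (?w $ i) (weighted_sum ?w x) \<subseteq> edges v \<union> drawing v t p"
    using sub subset_closed_segment unfolding wi by (meson ends_in_segment(1) order_trans)
  moreover have "closed_segment (?w $ i) (weighted_sum ?w x) \<subseteq> convex hull (range (($) ?w))"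
    using xV by (intro closed_segment_subset) (simp_all add: hull_inc, simp add: hull_eq_weighted_sum)
  ultimately have "closed_segment (?w $ i) (weighted_sum ?w x) \<subseteq>
      edges ?w \<union> drawing ?w (subtree j t) (\<lambda>u. p (j # u))"
    using drawing_Int_child[OF assms(1,2) V2, of v j] by blast
  moreover have "\<not> closed_segment (?w $ i) (weighted_sum ?w x) \<subseteq>
      edges ?w \<union> drawing ?w (subtree j t) (\<lambda>u. p (j # u))"
  proof (rule segment_not_in_drawing)
    show "x $ l > 0" if "l \<noteq> i" for l using distinct_indices[OF ijk, of l] that xj0 xk0 by auto
  qed (use assms xV xi ternary_tree_subtree nondegenerate_subdivide P internal_nodes_Cons in blast)+
  ultimately show False by blast
qed

text \<open>Sort the ratios \<open>r l = P' $ l / P $ l\<close> as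
  \<open>r i \<le> r j \<le> r k\<close>. If the second inequality is strict, the first alternative
  holds. Otherwise \<open>r i < r j\<close>, because equal ratios and equal sums would force
  \<open>P = P'\<close>; exchanging the two points inverts the ratios and reverses their
  order.\<close>

lemma ratio_orders:
  assumes P: "P \<in> V2_star" "P' \<in> V2_star" "P \<noteq> P'"
  obtains i j k where "i \<noteq> j" "j \<noteq> k" "i \<noteq> k"
      "P' $ i * P $ j \<le> P' $ j * P $ i" "P' $ j * P $ k < P' $ k * P $ j"
    | i j k where "i \<noteq> j" "j \<noteq> k" "i \<noteq> k"
      "P $ i * P' $ j \<le> P $ j * P' $ i" "P $ j * P' $ k < P $ k * P' $ j"
proof -
  have pos: "P $ l > 0" "P' $ l > 0" for l using P V2_star_D by blast+
  define r where "r l = P' $ l / P $ l" for l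
  have le: "r a \<le> r b \<longleftrightarrow> P' $ a * P $ b \<le> P' $ b * P $ a" for a b
    using pos[of a] pos[of b] by (simp add: r_def divide_simps)
  have "Min (range r) \<in> range r" by (rule Min_in) auto
  then obtain i where i: "r i = Min (range r)" by (metis imageE)
  then have min: "r i \<le> r l" for l by simp
  obtain j' k' where jk': "i \<noteq> j'" "j' \<noteq> k'" "i \<noteq> k'" using other_indices by metis
  obtain j k where ijk: "i \<noteq> j" "j \<noteq> k" "i \<noteq> k" and jk: "r j \<le> r k"
    using jk' by (metis linear)
  show ?thesis
  proof (cases "r j < r k")
    case True
    then show ?thesis using that(1)[OF ijk] min[of j] le[of i j] le[of k j] by (meson not_le)
  next
    case False
    then have eq: "r j = r k" using jk by simp
    have "r i \<noteq> r j"
    proof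
      assume "r i = r j"
      then have "r l = r i" for l using eq distinct_indices[OF ijk, of l] by auto
      then have l: "P' $ l = r i * P $ l" for l
        using pos[of l] by (metis r_def less_irrefl nonzero_eq_divide_eq)
      then have "(\<Sum>l\<in>UNIV. P' $ l) = r i * (\<Sum>l\<in>UNIV. P $ l)" by (simp add: sum_distrib_left)
      then have "r i = 1" using V2_star_D(2)[OF P(1)] V2_star_D(2)[OF P(2)] by simp
      then show False using l P(3) by (simp add: vec_eq_iff)
    qed
    then have "r i < r j" using min[of j] by simp
    then have "P $ j * P' $ i < P $ i * P' $ j" "P $ k * P' $ j \<le> P $ j * P' $ k"
      using le[of j i] le[of j k] eq by (auto simp: mult.commute not_le)
    \<comment> \<open>The reciprocal ratios increase along \<open>k\<close>, \<open>j\<close>,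
      \<open>i\<close>, with a strict step at the end.\<close>
    then show ?thesis using that(2)[of k j i] ijk by metis
  qed
qed

lemma root_point_in_drawing:
  assumes "[] \<in> internal_nodes t"
  shows "closed_segment (v $ i) (weighted_sum v (p [])) \<subseteq> drawing v t p"
  unfolding drawing_node[OF assms] by blast

lemma drawing_root_unique:
  fixes v :: "complex ^ 3"
  assumes "ternary_tree t" "\<forall>u\<in>internal_nodes t. p u \<in> V2_star" "[] \<in> internal_nodes t"
    and "ternary_tree t'" "\<forall>u\<in>internal_nodes t'. p' u \<in> V2_star" "[] \<in> internal_nodes t'"
    and "\<not> degenerate v" "edges v \<union> drawing v t p = edges v \<union> drawing v t' p'"
  shows "p [] = p' []"
proof (rule ccontr)
  assume "p [] \<noteq> p' []"
  have pp: "p [] \<in> V2_star" "p' [] \<in> V2_star" using assms by blast+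
  have sub: "closed_segment (v $ i) (weighted_sum v (p' [])) \<subseteq> edges v \<union> drawing v t p"
    "closed_segment (v $ i) (weighted_sum v (p [])) \<subseteq> edges v \<union> drawing v t' p'" for i
    using root_point_in_drawing[OF assms(6), of v i p'] root_point_in_drawing[OF assms(3), of v i p] assms(8)
    by blast+
  from pp \<open>p [] \<noteq> p' []\<close> show False
  proof (rule ratio_orders)
    fix i j k :: 3
    assume ijk: "i \<noteq> j" "j \<noteq> k" "i \<noteq> k"
    show False if "p' [] $ i * p [] $ j \<le> p' [] $ j * p [] $ i" "p' [] $ j * p [] $ k < p' [] $ k * p [] $ j"
      using root_segment_crosses[OF assms(1,3,2,7) pp(2) ijk that] sub(1) by blast
    show False if "p [] $ i * p' [] $ j \<le> p [] $ j * p' [] $ i" "p [] $ j * p' [] $ k < p [] $ k * p' [] $ j"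
      using root_segment_crosses[OF assms(4,6,5,7) pp(1) ijk that] sub(2) by blast
  qed
qed

lemma drawing_root_internal:
  fixes v :: "complex ^ 3"
  assumes "\<forall>u\<in>internal_nodes t. p u \<in> V2_star" "[] \<in> internal_nodes t" "\<not> degenerate v"
  shows "\<not> drawing v t p \<subseteq> edges v"
proof -
  have "weighted_sum v (p []) \<in> drawing v t p"
    using root_point_in_drawing[OF assms(2), of v 1 p] by auto
  moreover have "weighted_sum v (p []) \<in> open_triangle v"
    using assms by (intro weighted_sum_in_open_triangle) auto
  ultimately show ?thesis using open_triangle_Int_edges[of v] by blast
qed

text \<open>Once the root points agree, both subdivisions have the same parts, and intersecting the
  set with each part passes to the children. A root that is a leaf is recognised by the absence of
  drawn points off the perimeter.\<close>

lemma drawing_injective: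
  fixes v :: "complex ^ 3"
  assumes "ternary_tree t" "\<forall>u\<in>internal_nodes t. p u \<in> V2_star"
    and "ternary_tree t'" "\<forall>u\<in>internal_nodes t'. p' u \<in> V2_star"
    and "\<not> degenerate v" "edges v \<union> drawing v t p = edges v \<union> drawing v t' p'"
  shows "t = t' \<and> (\<forall>u\<in>internal_nodes t. p u = p' u)"
  using assms
proof (induction t arbitrary: v p t' p' rule: ternary_tree_induct)
  case leaf
  then have "[] \<notin> internal_nodes t'"
    using drawing_root_internal[of t' p' v] by (auto simp: drawing_singleton)
  then have "t' = {[]}" using ternary_tree_root_leaf leaf by blast
  then show ?case by (simp add: ternary_tree_singleton)
next
  case (node t)
  have t': "[] \<in> internal_nodes t'"
  proof (rule ccontr)
    assume "[] \<notin> internal_nodes t'"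
    then have "t' = {[]}" using ternary_tree_root_leaf node.prems by blast
    then have "edges v \<union> drawing v t p = edges v" using node.prems by (simp add: drawing_singleton)
    then show False using drawing_root_internal[of t p v] node.prems node(2) by blast
  qed
  have eq: "p [] = p' []"
    using node.prems node(1,2) t' by (intro drawing_root_unique[of t p t' p' v])
  have P: "p [] \<in> V2_star" using node by blast
  have V2: "\<forall>u\<in>internal_nodes t. p u \<in> V2" "\<forall>u\<in>internal_nodes t'. p' u \<in> V2"
    using node.prems V2_star_subset by blast+
  have child: "subtree i t = subtree i t' \<and> (\<forall>u\<in>internal_nodes (subtree i t). p (i # u) = p' (i # u))" for i
  proof (rule node.IH)
    show "\<forall>u\<in>internal_nodes (subtree i t). p (i # u) \<in> V2_star"
      "\<forall>u\<in>internal_nodes (subtree i t'). p' (i # u) \<in> V2_star"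
      using node.prems internal_nodes_Cons by blast+
    show "ternary_tree (subtree i t')" using ternary_tree_subtree[OF node.prems(2) t'] .
    show "\<not> degenerate (subdivide v i (p []))" by (rule nondegenerate_subdivide[OF node.prems(4) P])
    show "edges (subdivide v i (p [])) \<union> drawing (subdivide v i (p [])) (subtree i t) (\<lambda>u. p (i # u)) =
      edges (subdivide v i (p [])) \<union> drawing (subdivide v i (p [])) (subtree i t') (\<lambda>u. p' (i # u))"
      using drawing_Int_child[OF node(1,2) V2(1), of v i]
        drawing_Int_child[OF node.prems(2) t' V2(2), of v i] node.prems(5) eq by simp
  qed
  then have "t = t'" using ternary_tree_decompose[OF node(2)] ternary_tree_decompose[OF t'] by simp
  moreover have "\<forall>u\<in>internal_nodes t. p u = p' u"
    using child eq unfolding internal_nodes_decompose[OF node(2)] by auto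
  ultimately show ?case by blast
qed

section \<open>Distinctness of the inserted points\<close>

lemma node_point_in_open_triangle:
  fixes v :: "complex ^ 3"
  assumes "ternary_tree t" "\<forall>u\<in>internal_nodes t. p u \<in> V2_star" "\<not> degenerate v" "u \<in> internal_nodes t"
  shows "node_point v p u \<in> open_triangle (node_vertices v p u)"
  unfolding node_point_def
  using assms internal_nodes_subset
  by (intro weighted_sum_in_open_triangle node_vertices_nondegenerate[OF assms(1)]) blast+

lemma inj_node_point:
  fixes v :: "complex ^ 3"
  assumes "ternary_tree t" "\<forall>u\<in>internal_nodes t. p u \<in> V2_star" "\<not> degenerate v"
  shows "inj_on (node_point v p) (internal_nodes t)"
  using assms
proof (induction t arbitrary: v p rule: ternary_tree_induct)
  case leaf
  then show ?case by (simp add: ternary_tree_singleton)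
next
  case (node t)
  have P: "p [] \<in> V2_star" and PV: "p [] \<in> V2" using node V2_star_subset by blast+
  let ?w = "\<lambda>i. subdivide v i (p [])"
  have nd: "\<not> degenerate (?w i)" for i by (rule nondegenerate_subdivide[OF node.prems(2) P])
  have star: "\<forall>u\<in>internal_nodes (subtree i t). p (i # u) \<in> V2_star" for i
    using node.prems internal_nodes_Cons by blast
  then have V2: "\<forall>u\<in>internal_nodes (subtree i t). p (i # u) \<in> V2" for i
    using V2_star_subset by blast
  have inO: "node_point v p (i # u) \<in> open_triangle (?w i)" if "u \<in> internal_nodes (subtree i t)" for i u
    using node_point_in_open_triangle[OF node(3)[of i] star nd that]
      open_triangle_node_subset[OF node(3)[of i] _ V2, of u "?w i"] that internal_nodes_subset
    unfolding node_point_Cons by blast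
  have root: "node_point v p [] \<noteq> node_point v p (i # u)" if "u \<in> internal_nodes (subtree i t)" for i u
  proof -
    \<comment> \<open>The root point is a vertex of every part, so it is on the perimeter of the
      part and not in its interior, where all points below it are.\<close>
    have "node_point v p [] = ?w i $ i" by (simp add: node_point_def subdivide_nth)
    then show ?thesis
      using inO[OF that] vertex_in_edges[of "?w i" i] open_triangle_Int_edges[of "?w i"] by auto
  qed
  have sib: "i = j" if "node_point v p (i # u) = node_point v p (j # w)"
    "u \<in> internal_nodes (subtree i t)" "w \<in> internal_nodes (subtree j t)" for i j u w
    using open_triangle_Int_hull_sibling[OF PV, of i j v] inO[OF that(2)] inO[OF that(3)]
      open_triangle_subset_hull[of "?w j"] that(1) by fastforce
  have IH: "inj_on (node_point (?w i) (\<lambda>u. p (i # u))) (internal_nodes (subtree i t))" for i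
    by (rule node.IH[OF star nd])
  show ?case
  proof (rule inj_onI)
    fix a b assume ab: "a \<in> internal_nodes t" "b \<in> internal_nodes t" "node_point v p a = node_point v p b"
    show "a = b"
    proof (cases a; cases b)
      fix i u j w assume *: "a = i # u" "b = j # w"
      then have uw: "u \<in> internal_nodes (subtree i t)" "w \<in> internal_nodes (subtree j t)"
        using ab internal_nodes_Cons by blast+
      then have "i = j" using sib ab(3) * by blast
      then show ?thesis using inj_onD[OF IH[of i], of u w] uw ab(3) * by (simp add: node_point_Cons)
    qed (use ab root internal_nodes_Cons in \<open>(metis)+\<close>)
  qed
qed

section \<open>Insertion histories and trees\<close>

abbreviation leaf_face :: "(3 list \<Rightarrow> real ^ 3) \<Rightarrow> 3 list \<Rightarrow> complex set" where
  "leaf_face p l \<equiv> open_triangle (node_vertices ABC p l)"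

abbreviation tree_drawing :: "3 list set \<Rightarrow> (3 list \<Rightarrow> real ^ 3) \<Rightarrow> complex set" where
  "tree_drawing t p \<equiv> base_triangle \<union> drawing ABC t p"

definition point_tree :: "3 list set \<Rightarrow> (3 list \<Rightarrow> real ^ 3) \<Rightarrow> bool" where
  "point_tree t p \<longleftrightarrow> ternary_tree t \<and> (\<forall>u\<in>internal_nodes t. p u \<in> V2_star)"

text \<open>The last clause fixes the whole graph of \<open>\<sigma>\<close>, its domain as well as
  the order of the vertices of every face.\<close>

definition realises ::
  "3 list set \<Rightarrow> (3 list \<Rightarrow> real ^ 3) \<Rightarrow> complex set \<Rightarrow> (complex set \<rightharpoonup> complex ^ 3) \<Rightarrow> complex set \<Rightarrow> bool" where
  "realises t p m \<sigma> V \<longleftrightarrow> m = tree_drawing t p \<and> V = node_point ABC p ` internal_nodes t \<and>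
    (\<forall>f v. \<sigma> f = Some v \<longleftrightarrow> (\<exists>l\<in>leaves t. f = leaf_face p l \<and> v = node_vertices ABC p l))"

lemma realises_base: "realises {[]} p base_triangle [open_triangle ABC \<mapsto> ABC] {}"
  by (auto simp: realises_def ternary_tree_singleton drawing_singleton)

lemma ex_3: "(\<exists>i :: 3. Q i) \<longleftrightarrow> Q 1 \<or> Q 2 \<or> Q 3"
  by (metis exhaust_3)

text \<open>A point inserted in the face of leaf \<open>l\<close> turns \<open>l\<close> into an
  internal node. Old nodes keep their triangles, as these depend on points at proper prefixes only.
  The updates in \<open>split_face\<close> overwrite neither each other nor the surviving faces,
  because the leaf faces of the grown tree are distinct.\<close>

lemma realises_insert:
  assumes tp: "point_tree t p" and real: "realises t p m \<sigma> V" and l: "l \<in> leaves t" and P: "P \<in> V2_star"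
  defines "t' \<equiv> t \<union> range (\<lambda>i. l @ [i])" and "p' \<equiv> p(l := P)" and "v \<equiv> node_vertices ABC p l"
  defines "M \<equiv> weighted_sum v P"
  shows "point_tree t' p'"
    and "realises t' p' (m \<union> closed_segment (v $ 1) M \<union> closed_segment (v $ 2) M \<union> closed_segment (v $ 3) M)
      (split_face \<sigma> (leaf_face p l) v M) (insert M V)"
proof -
  have t: "ternary_tree t" and p: "\<forall>u\<in>internal_nodes t. p u \<in> V2_star"
    using tp by (auto simp: point_tree_def)
  note grow = grow_leaf[OF t l, folded t'_def]
  show tp': "point_tree t' p'"
    using grow p P by (auto simp: point_tree_def p'_def)
  have same: "\<forall>w\<in>internal_nodes t. p' w = p w" using grow(4) by (auto simp: p'_def)
  have nv: "node_vertices ABC p' u = node_vertices ABC p u" if "u \<in> t" for u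
    by (rule node_vertices_cong_tree[OF t that same])
  have lt: "l \<in> t" using l leaves_subset by blast
  have p'l: "p' l = P" by (simp add: p'_def)
  have nl: "node_vertices ABC p' (l @ [i]) = replace_entry v i M" for i
    by (simp add: node_vertices_snoc nv[OF lt] subdivide_def v_def M_def p'l)
  have np: "node_point ABC p' u = node_point ABC p u" if "u \<in> internal_nodes t" for u
    by (rule node_point_cong_tree[OF t that same])
  have npl: "node_point ABC p' l = M"
    by (simp add: node_point_def nv[OF lt] v_def M_def p'l)
  have D: "drawing ABC t' p' = drawing ABC t p \<union> (\<Union>i. closed_segment (v $ i) M)"
  proof -
    have "(\<Union>u\<in>internal_nodes t. \<Union>i. closed_segment (node_vertices ABC p' u $ i) (node_point ABC p' u))
        = drawing ABC t p"
      unfolding drawing_def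
      by (intro SUP_cong refl) (simp add: np nv internal_nodes_subset[THEN subsetD])
    then show ?thesis
      unfolding drawing_def[of _ t'] grow(2) UN_insert npl nv[OF lt] v_def[symmetric] by (simp add: Un_commute)
  qed
  have inj: "inj_on (leaf_face p) (leaves t)" "inj_on (leaf_face p') (leaves t')"
    using faces_drawing_bij[of t p] faces_drawing_bij[of t' p'] tp tp'
    by (simp_all add: point_tree_def bij_betw_def)
  let ?s = "split_face \<sigma> (leaf_face p l) v M"
  have new: "l @ [i] \<notin> t" for i using l by (auto simp: leaves_def)
  have lf: "leaf_face p' (l @ [i]) = open_triangle (replace_entry v i M)" for i by (simp add: nl)
  have distinct: "open_triangle (replace_entry v i M) = open_triangle (replace_entry v j M) \<longleftrightarrow> i = j" for i j
    using inj_onD[OF inj(2), of "l @ [i]" "l @ [j]"] grow(3) lf by auto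
  have old: "leaf_face p u \<noteq> open_triangle (replace_entry v i M)" "leaf_face p u \<noteq> leaf_face p l"
    if "u \<in> leaves t" "u \<noteq> l" for u i
  proof -
    have ut: "u \<in> t" using that leaves_subset by blast
    show "leaf_face p u \<noteq> open_triangle (replace_entry v i M)"
      using inj_onD[OF inj(2), of u "l @ [i]"] grow(3) lf that nv[OF ut] ut new[of i] by auto
    show "leaf_face p u \<noteq> leaf_face p l" using inj_onD[OF inj(1), of u l] that l by auto
  qed
  have s: "\<sigma> f = Some x \<longleftrightarrow> (\<exists>u\<in>leaves t. f = leaf_face p u \<and> x = node_vertices ABC p u)" for f x
    using real by (simp add: realises_def)
  have split: "?s f = Some x \<longleftrightarrow> (\<exists>i. f = open_triangle (replace_entry v i M) \<and> x = replace_entry v i M)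
      \<or> (\<forall>i. f \<noteq> open_triangle (replace_entry v i M)) \<and> f \<noteq> leaf_face p l \<and> \<sigma> f = Some x" for f x
    unfolding split_face_def ex_3 forall_3 using distinct by auto
  have "?s f = Some x \<longleftrightarrow> (\<exists>u\<in>leaves t'. f = leaf_face p' u \<and> x = node_vertices ABC p' u)" for f x
  proof
    assume "?s f = Some x"
    then consider i where "f = open_triangle (replace_entry v i M)" "x = replace_entry v i M"
      | "f \<noteq> leaf_face p l" "\<sigma> f = Some x" unfolding split by blast
    then show "\<exists>u\<in>leaves t'. f = leaf_face p' u \<and> x = node_vertices ABC p' u"
    proof cases
      case 1
      then show ?thesis using nl grow(3) by (intro bexI[of _ "l @ [i]"]) auto
    next
      case 2
      then obtain u where u: "u \<in> leaves t" "f = leaf_face p u" "x = node_vertices ABC p u" using s by blast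
      then have "u \<noteq> l" "u \<in> t" using 2 leaves_subset by auto
      then show ?thesis using u nv grow(3) by (intro bexI[of _ u]) auto
    qed
  next
    assume "\<exists>u\<in>leaves t'. f = leaf_face p' u \<and> x = node_vertices ABC p' u"
    then obtain u where u: "u \<in> leaves t'" "f = leaf_face p' u" "x = node_vertices ABC p' u" by blast
    then consider i where "u = l @ [i]" | "u \<in> leaves t" "u \<noteq> l" using grow(3) by blast
    then show "?s f = Some x"
    proof cases
      case 1
      then show ?thesis unfolding split using u nl by auto
    next
      case 2
      then have "u \<in> t" using leaves_subset by blast
      then have "f = leaf_face p u" "x = node_vertices ABC p u" using u nv by simp_all
      then show ?thesis unfolding split s using old[OF 2] 2(1) by blast
    qed
  qed
  moreover have "insert M V = node_point ABC p' ` internal_nodes t'"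
    using real np npl unfolding realises_def grow(2) by simp
  moreover have "m \<union> closed_segment (v $ 1) M \<union> closed_segment (v $ 2) M \<union> closed_segment (v $ 3) M = tree_drawing t' p'"
    using real unfolding realises_def D UNIV_3 by auto
  ultimately show "realises t' p' (m \<union> closed_segment (v $ 1) M \<union> closed_segment (v $ 2) M \<union> closed_segment (v $ 3) M)
      ?s (insert M V)"
    unfolding realises_def by blast
qed

lemma realises_faces:
  assumes "point_tree t p" "realises t p m \<sigma> V"
  shows "bij_betw (leaf_face p) (leaves t) (faces m)"
  using faces_drawing_bij[of t p] assms by (simp add: point_tree_def realises_def)

lemma leaf_face_eq:
  assumes "point_tree t p" "l \<in> leaves t"
  shows "leaf_face p l = weighted_sum (node_vertices ABC p l) ` V2_star"
  using assms leaves_subset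
  by (intro open_triangle_nondegenerate node_vertices_nondegenerate[of t] ABC_nondegenerate)
    (auto simp: point_tree_def)

lemma history_realised:
  assumes "triangulation_history k m \<sigma> V"
  shows "\<exists>t p. point_tree t p \<and> card (internal_nodes t) = k \<and> realises t p m \<sigma> V"
  using assms
proof induction
  case base
  show ?case
    by (intro exI[of _ "{[]}"] exI conjI realises_base)
      (simp_all add: point_tree_def ternary_tree_singleton)
next
  case (insert k m \<sigma> V f v M)
  then obtain t p where tp: "point_tree t p" "card (internal_nodes t) = k" "realises t p m \<sigma> V" by blast
  then obtain l where l: "l \<in> leaves t" "f = leaf_face p l" "v = node_vertices ABC p l"
    using insert.hyps(3) by (auto simp: realises_def)
  \<comment> \<open>The positive barycentric weights of \<open>M\<close> in its face become the
    point attached to the new internal node.\<close>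
  obtain P where P: "P \<in> V2_star" "M = weighted_sum v P"
    using insert.hyps(4) leaf_face_eq[OF tp(1) l(1)] l by auto
  have t: "ternary_tree t" using tp(1) by (simp add: point_tree_def)
  note grow = grow_leaf[OF t l(1)]
  have "card (internal_nodes (t \<union> range (\<lambda>i. l @ [i]))) = Suc k"
    using grow tp(2) ternary_tree_finite(3)[OF t] by simp
  then show ?case
    using realises_insert[OF tp(1,3) l(1) P(1)] unfolding P(2) l(2,3) by blast
qed

text \<open>A deepest internal node is pruned and inserted last. The point function stays the same
  throughout: the pruned tree does not read its value at \<open>l\<close>, and the insertion writes
  back the value it already has there.\<close>

lemma tree_realised:
  assumes "point_tree t p"
  shows "\<exists>m \<sigma> V. triangulation_history (card (internal_nodes t)) m \<sigma> V \<and> realises t p m \<sigma> V"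
  using assms
proof (induction "card (internal_nodes t)" arbitrary: t)
  case 0
  then have "internal_nodes t = {}" "ternary_tree t"
    using ternary_tree_finite(3) by (auto simp: point_tree_def)
  then have "t = {[]}" using ternary_tree_root_leaf by blast
  then show ?case
    using realises_base triangulation_history.base by (auto simp: ternary_tree_singleton)
next
  case (Suc n)
  have t: "ternary_tree t" and p: "\<forall>u\<in>internal_nodes t. p u \<in> V2_star"
    using Suc.prems by (auto simp: point_tree_def)
  have "internal_nodes t \<noteq> {}" using Suc.hyps(2) by auto
  then obtain s l where s: "ternary_tree s" "l \<in> leaves s" "t = s \<union> range (\<lambda>i. l @ [i])"
    using ungrow_leaf[OF t] by blast
  note grow = grow_leaf[OF s(1,2), folded s(3)]
  have card: "card (internal_nodes s) = n"
    using Suc.hyps(2) grow ternary_tree_finite(3)[OF s(1)] by simp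
  have sp: "point_tree s p" using p grow s(1) by (auto simp: point_tree_def)
  then obtain m \<sigma> V where h: "triangulation_history n m \<sigma> V" "realises s p m \<sigma> V"
    using Suc.hyps(1)[of s] card by blast
  have P: "p l \<in> V2_star" using p grow by simp
  let ?v = "node_vertices ABC p l"
  have "leaf_face p l \<in> faces m"
    using realises_faces[OF sp h(2)] s(2) by (auto simp: bij_betw_def)
  moreover have "\<sigma> (leaf_face p l) = Some ?v" using h(2) s(2) by (auto simp: realises_def)
  moreover have "weighted_sum ?v (p l) \<in> leaf_face p l" using leaf_face_eq[OF sp s(2)] P by simp
  ultimately show ?case
    using triangulation_history.insert[OF h(1)] realises_insert(2)[OF sp h(2) s(2) P]
    unfolding s(3)[symmetric] fun_upd_triv Suc.hyps(2)[symmetric] by blast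
qed

text \<open>Source of the independence from the history: injectivity of drawings identifies the tree
  of any history with the one already attached to the compact set.\<close>

lemma realises_unique:
  assumes "point_tree t p" "realises t p m \<sigma> V" "point_tree t' p'" "m = tree_drawing t' p'"
  shows "t' = t \<and> (\<forall>u\<in>internal_nodes t. p' u = p u)"
  using drawing_injective[of t p t' p' ABC] assms ABC_nondegenerate
  by (simp add: point_tree_def realises_def base_triangle_eq)

lemma realises_cong:
  assumes "ternary_tree t" "\<forall>u\<in>internal_nodes t. p' u = p u"
  shows "realises t p' m \<sigma> V = realises t p m \<sigma> V"
proof -
  have "node_vertices ABC p' l = node_vertices ABC p l" if "l \<in> leaves t" for l
    using node_vertices_cong_tree[OF assms(1) _ assms(2)] that leaves_subset by blast
  moreover have "node_point ABC p' ` internal_nodes t = node_point ABC p ` internal_nodes t"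
    using node_point_cong_tree[OF assms(1) _ assms(2)] by (intro image_cong refl)
  ultimately show ?thesis
    unfolding realises_def using drawing_cong[OF assms, of ABC] by simp
qed

section \<open>Coordinate-labelled trees\<close>

text \<open>The coordinate triple of the root, read as a triangle in R^3. Weighted sums of its
  vertices give back the weights.\<close>

definition unit_triple :: "real ^ 3 ^ 3" where
  "unit_triple = (\<chi> i. axis i 1)"

lemma unit_triple_eq: "unit_triple = vector [vector [1, 0, 0], vector [0, 1, 0], vector [0, 0, 1]]"
  by (simp add: unit_triple_def vec_eq_iff forall_3 axis_def)

text \<open>Subdivision forms only linear combinations of vertices, so it commutes with linear
  maps.\<close>

lemma linear_node_vertices:
  assumes "linear f"
  shows "f (node_vertices v p u $ i) = node_vertices (\<chi> i. f (v $ i)) p u $ i"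
proof (induction u arbitrary: i rule: rev_induct)
  case (snoc j u)
  have "f (weighted_sum (node_vertices v p u) (p u)) = weighted_sum (node_vertices (\<chi> i. f (v $ i)) p u) (p u)"
    using snoc by (simp add: weighted_sum_def linear_sum[OF assms] linear_scale[OF assms])
  then show ?case using snoc by (simp add: node_vertices_snoc subdivide_nth)
qed simp

text \<open>For \<open>w = ABC\<close> this says that the triple in a label consists of barycentric
  coordinates of the vertices of the node's triangle.\<close>

lemma weighted_sum_unit_triple:
  "weighted_sum w (node_vertices unit_triple p u $ i) = node_vertices w p u $ i"
  using linear_node_vertices[OF linear_weighted_sum[of w], of unit_triple p u i]
  by (simp add: unit_triple_def weighted_sum_axis)

lemma weighted_sum_node_unit_triple:
  "weighted_sum w (weighted_sum (node_vertices unit_triple p u) x) = weighted_sum (node_vertices w p u) x"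
  by (simp add: weighted_sum_def[of "node_vertices _ p u"] linear_sum[OF linear_weighted_sum]
      linear_scale[OF linear_weighted_sum] weighted_sum_unit_triple)

lemma weighted_sum_V2:
  assumes "\<And>i. w $ i \<in> V2" "x \<in> V2"
  shows "weighted_sum w x \<in> V2"
  unfolding weighted_sum_def using assms V2_D[OF assms(2)] by (intro convex_sum convex_V2) auto

lemma node_vertices_unit_triple_V2:
  assumes "ternary_tree t" "\<forall>u\<in>internal_nodes t. p u \<in> V2" "u \<in> t"
  shows "node_vertices unit_triple p u $ i \<in> V2"
  using assms(3)
proof (induction u arbitrary: i rule: rev_induct)
  case Nil
  then show ?case by (simp add: unit_triple_def axis_V2)
next
  case (snoc j u)
  then have "u \<in> t" "p u \<in> V2"
    using ternary_tree_prefix[OF assms(1)] prefix_internal[OF assms(1), of u j "[]"] assms(2) by auto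
  then show ?case using snoc.IH weighted_sum_V2 by (simp add: node_vertices_snoc subdivide_nth)
qed

definition labels_of :: "3 list set \<Rightarrow> (3 list \<Rightarrow> real ^ 3) \<Rightarrow> 3 list \<Rightarrow> label" where
  "labels_of t p u =
    (if u \<in> internal_nodes t then NodeLabel (node_vertices unit_triple p u) (p u)
     else if u \<in> leaves t then LeafLabel (node_vertices unit_triple p u) else undefined)"

lemma labels_of_outside:
  assumes "u \<notin> t"
  shows "labels_of t p u = undefined"
proof -
  have "u \<notin> internal_nodes t" "u \<notin> leaves t"
    using assms leaves_subset internal_nodes_subset by blast+
  then show ?thesis by (simp add: labels_of_def)
qed

lemma labels_of_CT:
  assumes "point_tree t p"
  shows "(t, labels_of t p) \<in> CT (card (internal_nodes t))"
proof -
  have t: "ternary_tree t" and p: "\<forall>u\<in>internal_nodes t. p u \<in> V2_star"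
    using assms by (auto simp: point_tree_def)
  have V2: "\<forall>u\<in>internal_nodes t. p u \<in> V2" using p V2_star_subset by blast
  have cases: "u \<in> internal_nodes t \<or> u \<in> leaves t" if "u \<in> t" for u
    using ternary_tree_leaf_or_internal[OF t that] by blast
  have leaf: "l \<notin> internal_nodes t" if "l \<in> leaves t" for l
    using that by (auto simp: leaves_def internal_nodes_def)
  have crd: "crd (labels_of t p u) = node_vertices unit_triple p u" if "u \<in> t" for u
    using cases[OF that] by (auto simp: labels_of_def)
  have "labels_of t p \<in> extensional t"
    by (simp add: extensional_def labels_of_outside)
  moreover have "[] \<in> t" using t by (simp add: ternary_tree_def)
  then have "crd (labels_of t p []) = vector [vector [1, 0, 0], vector [0, 1, 0], vector [0, 0, 1]]"
    by (simp add: crd unit_triple_eq)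
  moreover have "crd (labels_of t p (u @ [i])) = replace_entry (crd (labels_of t p u)) i
      (weighted_sum (crd (labels_of t p u)) (pnt (labels_of t p u)))" if "u \<in> internal_nodes t" for u i
  proof -
    have "u \<in> t" "u @ [i] \<in> t" using that by (auto simp: internal_nodes_def)
    then show ?thesis using that
      by (simp add: crd node_vertices_snoc subdivide_def) (simp add: labels_of_def)
  qed
  moreover have "\<exists>C. labels_of t p l = LeafLabel C \<and> (\<forall>i. C $ i \<in> V2)" if "l \<in> leaves t" for l
    using node_vertices_unit_triple_V2[OF t V2] leaf[OF that] that leaves_subset by (auto simp: labels_of_def)
  moreover have "\<exists>C P. labels_of t p u = NodeLabel C P \<and> (\<forall>i. C $ i \<in> V2) \<and> P \<in> V2_star"
    if "u \<in> internal_nodes t" for u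
    using node_vertices_unit_triple_V2[OF t V2, of u] that p internal_nodes_subset[of t]
    by (auto simp: labels_of_def)
  ultimately show ?thesis using t by (simp add: CT_def coord_labelled_tree_def)
qed

text \<open>The recursion for the coordinate triples has only one solution on a tree, so a labelled
  tree is determined by its tree and the points at the internal nodes.\<close>

lemma CT_D:
  assumes "(t, lam) \<in> CT n"
  shows "point_tree t (pnt \<circ> lam)" "card (internal_nodes t) = n" "lam = labels_of t (pnt \<circ> lam)"
proof -
  have c: "coord_labelled_tree (t, lam)" and "card (internal_nodes t) = n" using assms by (auto simp: CT_def)
  note c = c[unfolded coord_labelled_tree_def prod.case]
  have t: "ternary_tree t" and ext: "lam \<in> extensional t"
    and leaf: "\<And>l. l \<in> leaves t \<Longrightarrow> \<exists>C. lam l = LeafLabel C"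
    and int: "\<And>u. u \<in> internal_nodes t \<Longrightarrow> \<exists>C P. lam u = NodeLabel C P \<and> P \<in> V2_star"
    and root: "crd (lam []) = unit_triple"
    and rec: "\<And>u i. u \<in> internal_nodes t \<Longrightarrow> crd (lam (u @ [i])) =
          replace_entry (crd (lam u)) i (weighted_sum (crd (lam u)) (pnt (lam u)))"
    using c by (auto simp: unit_triple_eq)
  show "card (internal_nodes t) = n" by fact
  show "point_tree t (pnt \<circ> lam)"
    using t int by (fastforce simp: point_tree_def)
  have crd: "crd (lam u) = node_vertices unit_triple (pnt \<circ> lam) u" if "u \<in> t" for u
    using that
  proof (induction u rule: rev_induct)
    case (snoc i u)
    have u: "u \<in> internal_nodes t" using prefix_internal[OF t, of u i "[]"] snoc.prems by simp
    then have "crd (lam u) = node_vertices unit_triple (pnt \<circ> lam) u"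
      using snoc.IH internal_nodes_subset by blast
    then show ?case using rec[OF u] unfolding node_vertices_snoc subdivide_def comp_apply by simp
  qed (simp add: root)
  have "lam u = labels_of t (pnt \<circ> lam) u" for u
  proof (cases "u \<in> t")
    case True
    show ?thesis
    proof (cases "u \<in> internal_nodes t")
      case True
      then obtain C P where "lam u = NodeLabel C P" using int by blast
      then show ?thesis using True crd[of u] \<open>u \<in> t\<close> by (simp add: labels_of_def)
    next
      case False
      then have "u \<in> leaves t" using ternary_tree_leaf_or_internal[OF t \<open>u \<in> t\<close>] by blast
      then obtain C where "lam u = LeafLabel C" using leaf by blast
      then show ?thesis using False \<open>u \<in> leaves t\<close> crd[of u] \<open>u \<in> t\<close> by (simp add: labels_of_def)
    qed
  next
    case False
    show ?thesis unfolding labels_of_outside[OF False] by (rule extensional_arb[OF ext False])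
  qed
  then show "lam = labels_of t (pnt \<circ> lam)" by blast
qed

lemma labels_of_cong:
  assumes "ternary_tree t" "\<forall>u\<in>internal_nodes t. p u = q u"
  shows "labels_of t p = labels_of t q"
proof
  show "labels_of t p u = labels_of t q u" for u
    using node_vertices_cong_tree[OF assms(1) _ assms(2), of u unit_triple] assms(2)
      leaves_subset[of t] internal_nodes_subset[of t] by (auto simp: labels_of_def)
qed

text \<open>At a leaf \<open>pnt\<close> has an unspecified value, but a drawing reads points at
  internal nodes only.\<close>

definition triangulation_of :: "3 list set \<times> (3 list \<Rightarrow> label) \<Rightarrow> complex set" where
  "triangulation_of = (\<lambda>(t, lam). tree_drawing t (pnt \<circ> lam))"

lemma triangulation_of_bij: "bij_betw triangulation_of (CT n) (compact_triangulations n)"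
  unfolding bij_betw_def
proof
  show "inj_on triangulation_of (CT n)"
  proof (rule inj_onI)
    fix x y assume "x \<in> CT n" "y \<in> CT n" "triangulation_of x = triangulation_of y"
    moreover obtain t lam t' lam' where xy: "x = (t, lam)" "y = (t', lam')" by (metis surj_pair)
    ultimately have CT: "(t, lam) \<in> CT n" "(t', lam') \<in> CT n"
      and eq: "tree_drawing t (pnt \<circ> lam) = tree_drawing t' (pnt \<circ> lam')"
      by (auto simp: triangulation_of_def)
    note x = CT_D[OF CT(1)] and y = CT_D[OF CT(2)]
    have "t = t' \<and> (\<forall>u\<in>internal_nodes t. (pnt \<circ> lam) u = (pnt \<circ> lam') u)"
      using drawing_injective[of t "pnt \<circ> lam" t' "pnt \<circ> lam'" ABC] x(1) y(1) eq ABC_nondegenerate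
      unfolding point_tree_def base_triangle_eq by blast
    then show "x = y" using x(1,3) y(3) labels_of_cong[of t "pnt \<circ> lam" "pnt \<circ> lam'"] xy
      by (metis point_tree_def)
  qed
  show "triangulation_of ` CT n = compact_triangulations n"
  proof (intro equalityI subsetI)
    fix m assume "m \<in> triangulation_of ` CT n"
    then obtain t lam where "(t, lam) \<in> CT n" "m = tree_drawing t (pnt \<circ> lam)"
      by (auto simp: triangulation_of_def)
    then show "m \<in> compact_triangulations n"
      using CT_D(1,2)[of t lam n] tree_realised[of t "pnt \<circ> lam"]
      by (auto simp: compact_triangulations_def realises_def)
  next
    fix m assume "m \<in> compact_triangulations n"
    then obtain t p where tp: "point_tree t p" "card (internal_nodes t) = n" "m = tree_drawing t p"
      using history_realised unfolding compact_triangulations_def realises_def by blast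
    have "drawing ABC t (pnt \<circ> labels_of t p) = drawing ABC t p"
      using tp(1) by (intro drawing_cong) (auto simp: point_tree_def labels_of_def)
    then have "m = triangulation_of (t, labels_of t p)" by (simp add: triangulation_of_def tp(3))
    then show "m \<in> triangulation_of ` CT n" using labels_of_CT[OF tp(1)] tp(2) by blast
  qed
qed

lemma triangulation_of_vertices_faces:
  assumes CT: "(t, lam) \<in> CT n" and history: "triangulation_history n (triangulation_of (t, lam)) \<sigma> V"
  shows "bij_betw (node_point ABC (pnt \<circ> lam)) (internal_nodes t) V"
    and "u \<in> internal_nodes t \<Longrightarrow> lam u = NodeLabel C P \<Longrightarrow>
      barycentric_coords ABC (weighted_sum C P) (node_point ABC (pnt \<circ> lam) u)"
    and "bij_betw (leaf_face (pnt \<circ> lam)) (leaves t) (faces (triangulation_of (t, lam)))"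
    and "l \<in> leaves t \<Longrightarrow> lam l = LeafLabel D \<Longrightarrow>
      \<exists>v. \<sigma> (leaf_face (pnt \<circ> lam) l) = Some v \<and> (\<forall>i. barycentric_coords ABC (D $ i) (v $ i))"
proof -
  let ?p = "pnt \<circ> lam"
  note x = CT_D[OF CT]
  have t: "ternary_tree t" and star: "\<forall>u\<in>internal_nodes t. ?p u \<in> V2_star"
    using x(1) by (auto simp: point_tree_def)
  obtain t' p' where tp: "point_tree t' p'" "realises t' p' (triangulation_of (t, lam)) \<sigma> V"
    using history_realised[OF history] by blast
  \<comment> \<open>The history is arbitrary, and so at first is its tree; having the same drawing
    identifies it with \<open>t\<close>, and its faces and vertices become those of
    \<open>t\<close>.\<close>
  have "t = t' \<and> (\<forall>u\<in>internal_nodes t'. ?p u = p' u)"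
    by (rule realises_unique[OF tp x(1)]) (simp add: triangulation_of_def)
  then have real: "realises t ?p (triangulation_of (t, lam)) \<sigma> V"
    using realises_cong[OF t, of ?p p'] tp(2) by simp
  show "bij_betw (node_point ABC ?p) (internal_nodes t) V"
    using inj_node_point[OF t, of ?p ABC] star ABC_nondegenerate real
    unfolding bij_betw_def realises_def by blast
  show "bij_betw (leaf_face ?p) (leaves t) (faces (triangulation_of (t, lam)))"
    by (rule realises_faces[OF x(1) real])
  have V2: "\<forall>u\<in>internal_nodes t. ?p u \<in> V2" using star V2_star_subset by blast
  have lam: "lam u = labels_of t ?p u" for u using x(3) by metis
  show "barycentric_coords ABC (weighted_sum C P) (node_point ABC ?p u)"
    if u: "u \<in> internal_nodes t" "lam u = NodeLabel C P"
  proof -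
    have CP: "C = node_vertices unit_triple ?p u" "P = ?p u"
      using lam[of u] u by (auto simp: labels_of_def)
    have "weighted_sum C P \<in> V2"
      unfolding CP using node_vertices_unit_triple_V2[OF t V2] V2 u(1) internal_nodes_subset
      by (intro weighted_sum_V2) blast+
    then show ?thesis
      by (simp add: barycentric_coords_def V2_D node_point_def weighted_sum_node_unit_triple CP)
  qed
  show "\<exists>v. \<sigma> (leaf_face ?p l) = Some v \<and> (\<forall>i. barycentric_coords ABC (D $ i) (v $ i))"
    if l: "l \<in> leaves t" "lam l = LeafLabel D"
  proof -
    have D: "D = node_vertices unit_triple ?p l"
      using lam[of l] l ternary_tree_leaf_or_internal[OF t, of l] leaves_subset[of t]
      by (auto simp: labels_of_def)
    have "D $ i \<in> V2" for i
      unfolding D using node_vertices_unit_triple_V2[OF t V2] l(1) leaves_subset by blast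
    then have "barycentric_coords ABC (D $ i) (node_vertices ABC ?p l $ i)" for i
      by (simp add: barycentric_coords_def V2_D weighted_sum_unit_triple D)
    then show ?thesis using real l(1) by (auto simp: realises_def)
  qed
qed

section \<open>Convergence\<close>

text \<open>The distances on labels are fixed only up to their topology, so they are used through
  convergence alone.\<close>

lemma usual_distance_tendsto_iff:
  assumes "usual_distance d"
  shows "(f \<longlongrightarrow> l) F \<longleftrightarrow> (\<forall>\<epsilon>>0. \<forall>\<^sub>F x in F. d (f x) l < \<epsilon>)"
proof -
  interpret Metric_space UNIV d using assms by (simp add: usual_distance_def)
  have "mtopology = euclidean" using assms by (simp add: usual_distance_def)
  then show ?thesis using limitin_metric[of f l F] by simp
qed

text \<open>A sequence witnessing discontinuity keeps its images at distance at least
  \<open>\<epsilon>\<close> along every subsequence, so one convergent subsequence suffices. This is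
  what compactness provides for the inverse map.\<close>

lemma continuous_map_subsequences:
  assumes "Metric_space M d" "Metric_space M' d'" "f ` M \<subseteq> M'"
    and "\<And>x a. (\<And>k. x k \<in> M) \<Longrightarrow> a \<in> M \<Longrightarrow> (\<lambda>k. d (x k) a) \<longlonglongrightarrow> 0 \<Longrightarrow>
      \<exists>r. strict_mono r \<and> (\<lambda>k. d' (f (x (r k))) (f a)) \<longlonglongrightarrow> 0"
  shows "continuous_map (Metric_space.mtopology M d) (Metric_space.mtopology M' d') f"
  unfolding Metric_space.metric_continuous_map[OF assms(1,2)]
proof (intro conjI ballI allI impI)
  show "f ` M \<subseteq> M'" by fact
  fix a and \<epsilon> :: real assume a: "a \<in> M" and \<epsilon>: "\<epsilon> > 0"
  show "\<exists>\<delta>>0. \<forall>x. x \<in> M \<and> d a x < \<delta> \<longrightarrow> d' (f a) (f x) < \<epsilon>"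
  proof (rule ccontr)
    assume "\<not> ?thesis"
    then have "\<exists>x. x \<in> M \<and> d a x < inverse (real (Suc k)) \<and> \<not> d' (f a) (f x) < \<epsilon>" for k
      by (metis inverse_positive_iff_positive of_nat_0_less_iff zero_less_Suc)
    then obtain x where x: "\<And>k. x k \<in> M" "\<And>k. d a (x k) < inverse (real (Suc k))"
      "\<And>k. \<not> d' (f a) (f (x k)) < \<epsilon>" by metis
    have "(\<lambda>k. d (x k) a) \<longlonglongrightarrow> 0"
    proof (rule tendsto_sandwich)
      show "\<forall>\<^sub>F k in sequentially. 0 \<le> d (x k) a"
        using Metric_space.nonneg[OF assms(1)] by simp
      show "\<forall>\<^sub>F k in sequentially. d (x k) a \<le> inverse (real (Suc k))"
        using x(2) Metric_space.commute[OF assms(1), of a] by (simp add: less_imp_le)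
    qed (use LIMSEQ_inverse_real_of_nat in auto)
    then obtain r where "(\<lambda>k. d' (f (x (r k))) (f a)) \<longlonglongrightarrow> 0"
      using assms(4)[of x, OF x(1) a] by blast
    then have "\<forall>\<^sub>F k in sequentially. d' (f (x (r k))) (f a) < \<epsilon>"
      using \<epsilon> by (rule order_tendstoD(2))
    then show False
      using x(3) Metric_space.commute[OF assms(2), of "f a"] by simp
  qed
qed

text \<open>The elements of \<open>A\<close> are treated one after another; refining the subsequence
  for the next one keeps the limits already obtained.\<close>

lemma compact_subsequence_finite:
  fixes f :: "nat \<Rightarrow> 'a \<Rightarrow> 'b::metric_space"
  assumes "finite A" "compact K" "\<forall>k. \<forall>u\<in>A. f k u \<in> K"
  shows "\<exists>r q. strict_mono (r :: nat \<Rightarrow> nat) \<and> (\<forall>u\<in>A. q u \<in> K \<and> (\<lambda>k. f (r k) u) \<longlonglongrightarrow> q u)"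
  using assms(1,3)
proof (induction A rule: finite_induct)
  case empty
  have "strict_mono (id :: nat \<Rightarrow> nat)" by (simp add: strict_mono_def)
  then show ?case by blast
next
  case (insert a A)
  then obtain r q where r: "strict_mono (r :: nat \<Rightarrow> nat)"
    and q: "\<forall>u\<in>A. q u \<in> K \<and> (\<lambda>k. f (r k) u) \<longlonglongrightarrow> q u" by blast
  have "\<forall>k. f (r k) a \<in> K" using insert.prems by simp
  then obtain l s where s: "l \<in> K" "strict_mono s" "((\<lambda>k. f (r k) a) \<circ> s) \<longlonglongrightarrow> l"
    using seq_compactE[OF compact_imp_seq_compact[OF assms(2)], of "\<lambda>k. f (r k) a"] by metis
  have A: "(\<lambda>k. f ((r \<circ> s) k) u) \<longlonglongrightarrow> q u" if "u \<in> A" for u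
  proof -
    have "(\<lambda>k. f (r k) u) \<longlonglongrightarrow> q u" by (rule conjunct2[OF bspec[OF q that]])
    then have "((\<lambda>k. f (r k) u) \<circ> s) \<longlonglongrightarrow> q u" by (rule LIMSEQ_subseq_LIMSEQ[OF _ s(2)])
    then show ?thesis unfolding comp_def .
  qed
  have a: "(\<lambda>k. f ((r \<circ> s) k) a) \<longlonglongrightarrow> l" using s(3) unfolding comp_def .
  have "\<forall>u\<in>insert a A. (q(a := l)) u \<in> K \<and> (\<lambda>k. f ((r \<circ> s) k) u) \<longlonglongrightarrow> (q(a := l)) u"
  proof
    fix u assume "u \<in> insert a A"
    then show "(q(a := l)) u \<in> K \<and> (\<lambda>k. f ((r \<circ> s) k) u) \<longlonglongrightarrow> (q(a := l)) u"
      using q s(1) a A[of u] by (cases "u = a") simp_all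
  qed
  then show ?case using strict_mono_o[OF r s(2)] by blast
qed

lemma compact_V2: "compact V2"
proof -
  have "weighted_sum unit_triple x = x" for x
    by (simp add: weighted_sum_def unit_triple_def vec_eq_iff axis_def if_distrib cong: if_cong)
  then have "V2 = convex hull (range (($) unit_triple))" by (simp add: hull_eq_weighted_sum)
  moreover have "compact (convex hull (range (($) unit_triple)))"
    by (intro compact_convex_hull finite_imp_compact) simp
  ultimately show ?thesis by metis
qed

section \<open>Continuous dependence of a drawing on its points\<close>

lemma tendsto_node_vertices:
  fixes v :: "'a::real_normed_vector ^ 3"
  assumes "ternary_tree t" "\<forall>u\<in>internal_nodes t. ((\<lambda>k. p k u) \<longlongrightarrow> q u) F" "u \<in> t"
  shows "((\<lambda>k. node_vertices v (p k) u $ i) \<longlongrightarrow> node_vertices v q u $ i) F"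
  using assms(3)
proof (induction u arbitrary: i rule: rev_induct)
  case (snoc j u)
  then have "u \<in> t" "((\<lambda>k. p k u) \<longlongrightarrow> q u) F"
    using ternary_tree_prefix[OF assms(1)] prefix_internal[OF assms(1), of u j "[]"] assms(2) by auto
  then have "((\<lambda>k. weighted_sum (node_vertices v (p k) u) (p k u)) \<longlongrightarrow> weighted_sum (node_vertices v q u) (q u)) F"
    unfolding weighted_sum_def by (intro tendsto_sum tendsto_scaleR tendsto_vec_nth snoc.IH)
  then show ?case
    using snoc.IH[OF \<open>u \<in> t\<close>, of i] unfolding node_vertices_snoc subdivide_nth by (cases "i = j") simp_all
qed simp

lemma tendsto_node_point:
  fixes v :: "'a::real_normed_vector ^ 3"
  assumes "ternary_tree t" "\<forall>u\<in>internal_nodes t. ((\<lambda>k. p k u) \<longlongrightarrow> q u) F" "u \<in> internal_nodes t"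
  shows "((\<lambda>k. node_point v (p k) u) \<longlongrightarrow> node_point v q u) F"
  unfolding node_point_def weighted_sum_def
  using assms(2,3) internal_nodes_subset[of t]
  by (intro tendsto_sum tendsto_scaleR tendsto_vec_nth tendsto_node_vertices[OF assms(1,2)]) auto

text \<open>Points with the same parameter on the two segments are no farther apart than the two
  pairs of endpoints together.\<close>

lemma infdist_closed_segment_le:
  fixes a :: "'a::real_normed_vector"
  assumes "z \<in> closed_segment a b"
  shows "infdist z (closed_segment a' b') \<le> dist a a' + dist b b'"
proof -
  obtain u where u: "0 \<le> u" "u \<le> 1" "z = (1 - u) *\<^sub>R a + u *\<^sub>R b"
    using assms by (auto simp: in_segment)
  let ?z = "(1 - u) *\<^sub>R a' + u *\<^sub>R b'"
  have "z - ?z = (1 - u) *\<^sub>R (a - a') + u *\<^sub>R (b - b')" by (simp add: u algebra_simps)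
  then have "dist z ?z \<le> (1 - u) * dist a a' + u * dist b b'"
    using norm_triangle_ineq[of "(1 - u) *\<^sub>R (a - a')" "u *\<^sub>R (b - b')"] u by (simp add: dist_norm)
  also have "\<dots> \<le> dist a a' + dist b b'"
    using u by (intro add_mono mult_left_le_one_le) auto
  finally have "dist z ?z \<le> dist a a' + dist b b'" .
  moreover have "?z \<in> closed_segment a' b'" using u by (auto simp: in_segment)
  ultimately show ?thesis by (rule infdist_le2[rotated])
qed

text \<open>The total displacement of all segment endpoints. It is a crude bound for the Hausdorff
  distance, but as a finite sum it tends to zero term by term.\<close>

definition drawing_dist :: "3 list set \<Rightarrow> (3 list \<Rightarrow> real ^ 3) \<Rightarrow> (3 list \<Rightarrow> real ^ 3) \<Rightarrow> real" where
  "drawing_dist t p q = (\<Sum>u\<in>internal_nodes t. \<Sum>i\<in>UNIV.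
     dist (node_vertices ABC p u $ i) (node_vertices ABC q u $ i) + dist (node_point ABC p u) (node_point ABC q u))"

lemma drawing_dist_nonneg: "0 \<le> drawing_dist t p q"
  unfolding drawing_dist_def by (intro sum_nonneg) simp

lemma infdist_tree_drawing_le:
  assumes "ternary_tree t" "z \<in> tree_drawing t p"
  shows "infdist z (tree_drawing t q) \<le> drawing_dist t p q"
proof (cases "z \<in> base_triangle")
  case True
  then show ?thesis using drawing_dist_nonneg[of t p q] by simp
next
  case False
  then obtain u i where u: "u \<in> internal_nodes t"
    and z: "z \<in> closed_segment (node_vertices ABC p u $ i) (node_point ABC p u)"
    using assms(2) by (auto simp: drawing_def)
  let ?S = "closed_segment (node_vertices ABC q u $ i) (node_point ABC q u)"
  let ?d = "\<lambda>u i. dist (node_vertices ABC p u $ i) (node_vertices ABC q u $ i) + dist (node_point ABC p u) (node_point ABC q u)"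
  have "infdist z (tree_drawing t q) \<le> infdist z ?S"
    using u by (intro infdist_mono) (auto simp: drawing_def)
  also have "\<dots> \<le> ?d u i" by (rule infdist_closed_segment_le[OF z])
  also have "\<dots> \<le> (\<Sum>i\<in>UNIV. ?d u i)" by (rule member_le_sum) auto
  also have "\<dots> \<le> drawing_dist t p q"
    unfolding drawing_dist_def using ternary_tree_finite[OF assms(1)] u
    by (intro member_le_sum[of u _ "\<lambda>u. \<Sum>i\<in>UNIV. ?d u i"] sum_nonneg) auto
  finally show ?thesis .
qed

lemma compact_tree_drawing:
  assumes "ternary_tree t"
  shows "compact (tree_drawing t p)" "tree_drawing t p \<noteq> {}"
  unfolding drawing_def using base_triangle_compact ternary_tree_finite[OF assms]
  by (auto intro!: compact_Un compact_UN)

lemma hausdorff_tree_drawing_le: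
  assumes "ternary_tree t"
  shows "hausdorff_dist (tree_drawing t p) (tree_drawing t q) \<le> drawing_dist t p q"
proof (rule hausdorff_dist_le)
  have "drawing_dist t q p = drawing_dist t p q" by (simp add: drawing_dist_def dist_commute)
  then show "infdist z (tree_drawing t p) \<le> drawing_dist t p q" if "z \<in> tree_drawing t q" for z
    using infdist_tree_drawing_le[OF assms that, of p] by simp
qed (use infdist_tree_drawing_le[OF assms] compact_tree_drawing[OF assms] in auto)

lemma hausdorff_tree_drawing_tendsto:
  assumes "ternary_tree t" "\<forall>u\<in>internal_nodes t. ((\<lambda>k. p k u) \<longlongrightarrow> q u) F"
  shows "((\<lambda>k. hausdorff_dist (tree_drawing t (p k)) (tree_drawing t q)) \<longlongrightarrow> 0) F"
proof (rule tendsto_sandwich)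
  show "\<forall>\<^sub>F k in F. 0 \<le> hausdorff_dist (tree_drawing t (p k)) (tree_drawing t q)"
    using compact_tree_drawing[OF assms(1)] hausdorff_dist_nonneg by (intro always_eventually allI) blast
  show "\<forall>\<^sub>F k in F. hausdorff_dist (tree_drawing t (p k)) (tree_drawing t q) \<le> drawing_dist t (p k) q"
    using hausdorff_tree_drawing_le[OF assms(1)] by simp
  have "((\<lambda>k. drawing_dist t (p k) q) \<longlongrightarrow> (\<Sum>u\<in>internal_nodes t. \<Sum>i\<in>(UNIV :: 3 set). 0 + 0)) F"
    unfolding drawing_dist_def using internal_nodes_subset[of t]
    by (intro tendsto_sum tendsto_add tendsto_dist_iff[THEN iffD1]
        tendsto_node_vertices[OF assms] tendsto_node_point[OF assms]) auto
  then show "((\<lambda>k. drawing_dist t (p k) q) \<longlongrightarrow> 0) F" by simp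
qed simp

text \<open>Stated for compact sets instead of members of \<open>compact_triangulations n\<close>,
  because the limit of drawings is not known to be a triangulation when this is applied.\<close>

lemma hausdorff_limit_unique:
  fixes K L :: "'a::heine_borel set"
  assumes "compact K" "K \<noteq> {}" "compact L" "L \<noteq> {}" "\<And>k. compact (X k) \<and> X k \<noteq> {}"
    and "(\<lambda>k. hausdorff_dist (X k) K) \<longlonglongrightarrow> 0" "(\<lambda>k. hausdorff_dist (X k) L) \<longlonglongrightarrow> 0"
  shows "K = L"
proof -
  have "hausdorff_dist K L \<le> hausdorff_dist (X k) K + hausdorff_dist (X k) L" for k
  proof (rule hausdorff_dist_le)
    show "infdist x L \<le> hausdorff_dist (X k) K + hausdorff_dist (X k) L" if "x \<in> K" for x
      using infdist_triangle_hausdorff[of K "X k" L x] assms that by (simp add: hausdorff_dist_commute)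
    show "infdist x K \<le> hausdorff_dist (X k) K + hausdorff_dist (X k) L" if "x \<in> L" for x
      using infdist_triangle_hausdorff[of L "X k" K x] assms that
      by (simp add: hausdorff_dist_commute add.commute)
  qed (use assms in auto)
  moreover have "(\<lambda>k. hausdorff_dist (X k) K + hausdorff_dist (X k) L) \<longlonglongrightarrow> 0 + 0"
    by (intro tendsto_add assms)
  ultimately have "hausdorff_dist K L \<le> 0" by (intro LIMSEQ_le_const[of _ "0::real"]) auto
  then have "hausdorff_dist K L = 0" using hausdorff_dist_nonneg[OF assms(1,2), of L] by linarith
  then show ?thesis
    using hausdorff_dist_0_subset[of K L] hausdorff_dist_0_subset[of L K] assms
    by (auto simp: hausdorff_dist_commute)
qed

section \<open>Convergence of labelled trees\<close>

lemma CT_labels: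
  assumes "(t, lam) \<in> CT n"
  shows "u \<in> internal_nodes t \<Longrightarrow> lam u = NodeLabel (node_vertices unit_triple (pnt \<circ> lam) u) (pnt (lam u))"
    and "u \<in> leaves t \<Longrightarrow> lam u = LeafLabel (node_vertices unit_triple (pnt \<circ> lam) u)"
proof -
  have eq: "lam u = labels_of t (pnt \<circ> lam) u" using CT_D(3)[OF assms] by metis
  show "lam u = NodeLabel (node_vertices unit_triple (pnt \<circ> lam) u) (pnt (lam u))" if "u \<in> internal_nodes t"
    using that by (subst eq) (simp add: labels_of_def)
  show "lam u = LeafLabel (node_vertices unit_triple (pnt \<circ> lam) u)" if "u \<in> leaves t"
  proof -
    have "u \<notin> internal_nodes t" using that by (auto simp: leaves_def internal_nodes_def)
    then show ?thesis using that by (subst eq) (simp add: labels_of_def)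
  qed
qed

text \<open>Different trees are at distance one, so a distance below one fixes the tree; the cut-off
  is then inactive and the bound reaches each label.\<close>

lemma tree_dist_less_D:
  assumes "tree_dist dl dn (t', lam') (t, lam) < min 1 \<epsilon>" "finite t" "u \<in> t"
  shows "t' = t" "label_dist dl dn (lam' u) (lam u) < \<epsilon>"
proof -
  show "t' = t" using assms(1) by (auto simp: tree_dist_def split: if_splits)
  then have "(MAX u\<in>t. label_dist dl dn (lam' u) (lam u)) < \<epsilon>"
    using assms(1) by (auto simp: tree_dist_def)
  moreover have "label_dist dl dn (lam' u) (lam u) \<le> (MAX u\<in>t. label_dist dl dn (lam' u) (lam u))"
    using assms by (intro Max_ge) auto
  ultimately show "label_dist dl dn (lam' u) (lam u) < \<epsilon>" by linarith
qed

lemma tree_dist_tendsto_D: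
  assumes dn: "usual_distance dn"
    and x: "\<And>k. (s k, mu k) \<in> CT n" and a: "(t, lam) \<in> CT n"
    and lim: "(\<lambda>k. tree_dist dl dn (s k, mu k) (t, lam)) \<longlonglongrightarrow> 0"
  shows "\<forall>\<^sub>F k in sequentially. s k = t"
    and "\<forall>u\<in>internal_nodes t. (\<lambda>k. (pnt \<circ> mu k) u) \<longlonglongrightarrow> (pnt \<circ> lam) u"
proof -
  have t: "ternary_tree t" using CT_D(1)[OF a] by (simp add: point_tree_def)
  have small: "\<forall>\<^sub>F k in sequentially. tree_dist dl dn (s k, mu k) (t, lam) < min 1 \<epsilon>" if "\<epsilon> > 0" for \<epsilon>
    using lim that by (intro order_tendstoD) auto
  have "[] \<in> t" using t by (simp add: ternary_tree_def)
  then show "\<forall>\<^sub>F k in sequentially. s k = t"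
    using small[OF zero_less_one] tree_dist_less_D(1)[OF _ ternary_tree_finite(1)[OF t]]
    by (elim eventually_mono) blast
  show "\<forall>u\<in>internal_nodes t. (\<lambda>k. (pnt \<circ> mu k) u) \<longlonglongrightarrow> (pnt \<circ> lam) u"
  proof
    fix u assume u: "u \<in> internal_nodes t"
    let ?C = "\<lambda>lam. node_vertices unit_triple (pnt \<circ> lam) u"
    \<comment> \<open>\<open>dn\<close> compares coordinates and point together, so convergence is
      shown for the pair and then projected to the point.\<close>
    have "(\<lambda>k. (?C (mu k), pnt (mu k u))) \<longlonglongrightarrow> (?C lam, pnt (lam u))"
      unfolding usual_distance_tendsto_iff[OF dn]
    proof (intro allI impI)
      fix \<epsilon> :: real assume "\<epsilon> > 0"
      show "\<forall>\<^sub>F k in sequentially. dn (?C (mu k), pnt (mu k u)) (?C lam, pnt (lam u)) < \<epsilon>"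
        using small[OF \<open>\<epsilon> > 0\<close>]
      proof eventually_elim
        case (elim k)
        have ut: "u \<in> t" using u internal_nodes_subset by blast
        note less = tree_dist_less_D[OF elim ternary_tree_finite(1)[OF t] ut]
        have "u \<in> internal_nodes (s k)" using less(1) u by simp
        then have "mu k u = NodeLabel (?C (mu k)) (pnt (mu k u))" by (rule CT_labels(1)[OF x])
        moreover have "lam u = NodeLabel (?C lam) (pnt (lam u))" by (rule CT_labels(1)[OF a u])
        ultimately show ?case using less(2) by (metis label_dist.simps(2))
      qed
    qed
    then have "(\<lambda>k. snd (?C (mu k), pnt (mu k u))) \<longlonglongrightarrow> snd (?C lam, pnt (lam u))"
      by (rule tendsto_snd)
    then show "(\<lambda>k. (pnt \<circ> mu k) u) \<longlonglongrightarrow> (pnt \<circ> lam) u" by simp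
  qed
qed

text \<open>The coordinate triples depend continuously on the points, so convergence of the points
  yields convergence of all the finitely many labels, including those at the leaves.\<close>

lemma tree_dist_tendsto_I:
  assumes dl: "usual_distance dl" and dn: "usual_distance dn"
    and x: "\<And>k. (t, mu k) \<in> CT n" and a: "(t, lam) \<in> CT n"
    and lim: "\<forall>u\<in>internal_nodes t. (\<lambda>k. (pnt \<circ> mu k) u) \<longlonglongrightarrow> (pnt \<circ> lam) u"
  shows "(\<lambda>k. tree_dist dl dn (t, mu k) (t, lam)) \<longlonglongrightarrow> 0"
proof -
  have t: "ternary_tree t" using CT_D(1)[OF a] by (simp add: point_tree_def)
  have fin: "finite t" "t \<noteq> {}" using CT_properties[OF a] by auto
  interpret Metric_space "CT n" "restrict_dist (CT n) (tree_dist dl dn)"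
    using dl dn by (intro Metric_space_CT) (simp_all add: usual_distance_def)
  have nonneg: "0 \<le> tree_dist dl dn (t, mu k) (t, lam)" for k
    using nonneg[of "(t, mu k)" "(t, lam)"] x a by (simp add: restrict_dist_def)
  let ?C = "\<lambda>u lam. node_vertices unit_triple (pnt \<circ> lam) u"
  have C: "(\<lambda>k. ?C u (mu k)) \<longlonglongrightarrow> ?C u lam" if "u \<in> t" for u
    by (intro vec_tendstoI tendsto_node_vertices[OF t lim that])
  have ev: "\<forall>\<^sub>F k in sequentially. label_dist dl dn (mu k u) (lam u) < \<epsilon>" if "u \<in> t" "\<epsilon> > 0" for u \<epsilon>
  proof (cases "u \<in> internal_nodes t")
    case True
    have "(\<lambda>k. (?C u (mu k), pnt (mu k u))) \<longlonglongrightarrow> (?C u lam, pnt (lam u))"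
      using C[OF that(1)] lim True by (intro tendsto_Pair) auto
    then have "\<forall>\<^sub>F k in sequentially. dn (?C u (mu k), pnt (mu k u)) (?C u lam, pnt (lam u)) < \<epsilon>"
      using that(2) unfolding usual_distance_tendsto_iff[OF dn] by blast
    then show ?thesis
      using CT_labels(1)[OF x True] CT_labels(1)[OF a True]
      by (elim eventually_mono) (metis label_dist.simps(2))
  next
    case False
    then have l: "u \<in> leaves t" using that(1) ternary_tree_leaf_or_internal[OF t] by blast
    have "\<forall>\<^sub>F k in sequentially. dl (?C u (mu k)) (?C u lam) < \<epsilon>"
      using that(2) C[OF that(1)] unfolding usual_distance_tendsto_iff[OF dl] by blast
    then show ?thesis
      using CT_labels(2)[OF x l] CT_labels(2)[OF a l]
      by (elim eventually_mono) (metis label_dist.simps(1))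
  qed
  show ?thesis
  proof (rule order_tendstoI)
    fix e :: real assume "e < 0"
    then show "\<forall>\<^sub>F k in sequentially. e < tree_dist dl dn (t, mu k) (t, lam)"
      using nonneg by (intro always_eventually allI) (rule less_le_trans)
  next
    fix e :: real assume "0 < e"
    then have "\<forall>\<^sub>F k in sequentially. \<forall>u\<in>t. label_dist dl dn (mu k u) (lam u) < e"
      using ev by (intro eventually_ball_finite fin) auto
    then show "\<forall>\<^sub>F k in sequentially. tree_dist dl dn (t, mu k) (t, lam) < e"
      by (rule eventually_mono) (use fin in \<open>auto simp: tree_dist_def min_less_iff_disj\<close>)
  qed
qed

section \<open>The homeomorphism\<close>

lemma triangulation_of_tendsto:
  assumes dn: "usual_distance dn"
    and x: "\<And>k. x k \<in> CT n" and a: "a \<in> CT n"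
    and lim: "(\<lambda>k. tree_dist dl dn (x k) a) \<longlonglongrightarrow> 0"
  shows "(\<lambda>k. hausdorff_dist (triangulation_of (x k)) (triangulation_of a)) \<longlonglongrightarrow> 0"
proof -
  obtain t lam where a': "a = (t, lam)" by (metis surj_pair)
  have x': "(fst (x k), snd (x k)) \<in> CT n" for k using x by simp
  have t: "ternary_tree t" using CT_D(1)[of t lam n] a a' by (simp add: point_tree_def)
  note conv = tree_dist_tendsto_D[of dn "\<lambda>k. fst (x k)" "\<lambda>k. snd (x k)" n t lam dl, OF dn x' a[unfolded a']]
  have "(\<lambda>k. hausdorff_dist (tree_drawing t (pnt \<circ> snd (x k))) (tree_drawing t (pnt \<circ> lam))) \<longlonglongrightarrow> 0"
    using conv(2) lim a' by (intro hausdorff_tree_drawing_tendsto[OF t]) simp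
  moreover have "\<forall>\<^sub>F k in sequentially. hausdorff_dist (tree_drawing t (pnt \<circ> snd (x k))) (tree_drawing t (pnt \<circ> lam))
      = hausdorff_dist (triangulation_of (x k)) (triangulation_of a)"
    using conv(1) lim a' by (auto elim!: eventually_mono simp: triangulation_of_def split_beta)
  ultimately show ?thesis by (rule Lim_transform_eventually)
qed

lemma triangulation_of_subsequence:
  assumes dl: "usual_distance dl" and dn: "usual_distance dn"
    and x: "\<And>k. x k \<in> CT n" and a: "a \<in> CT n"
    and lim: "(\<lambda>k. hausdorff_dist (triangulation_of (x k)) (triangulation_of a)) \<longlonglongrightarrow> 0"
  shows "\<exists>r. strict_mono r \<and> (\<lambda>k. tree_dist dl dn (x (r k)) a) \<longlonglongrightarrow> 0"
proof -
  obtain t lam where a': "a = (t, lam)" by (metis surj_pair)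
  note CTa = CT_D[OF a[unfolded a']]
  have CTx: "point_tree (fst (x k)) (pnt \<circ> snd (x k))" "card (internal_nodes (fst (x k))) = n" for k
    using CT_D(1,2)[of "fst (x k)" "snd (x k)" n] x by simp_all
  have t: "ternary_tree t" using CTa(1) by (simp add: point_tree_def)
  \<comment> \<open>Only finitely many trees have \<open>n\<close> internal nodes, so one of them,
    called \<open>s\<close> below, occurs infinitely often.\<close>
  have "range (\<lambda>k. fst (x k)) \<subseteq> {s. ternary_tree s \<and> card (internal_nodes s) = n}"
    using CTx by (auto simp: point_tree_def)
  then have "finite (range (\<lambda>k. fst (x k)))" by (rule finite_subset[OF _ finite_ternary_trees])
  then obtain k0 where k0: "infinite {k. fst (x k) = fst (x k0)}"
    using pigeonhole_infinite[of "UNIV :: nat set" "\<lambda>k. fst (x k)"] by auto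
  define s where "s = fst (x k0)"
  obtain r1 :: "nat \<Rightarrow> nat" where r1: "strict_mono r1" "\<And>k. fst (x (r1 k)) = s"
    using infinite_enumerate[OF k0] by (auto simp: s_def)
  have s: "ternary_tree s" "card (internal_nodes s) = n" using CTx[of k0] by (auto simp: s_def point_tree_def)
  have "\<forall>k. \<forall>u\<in>internal_nodes s. (pnt \<circ> snd (x (r1 k))) u \<in> V2"
    using CTx(1)[of "r1 _"] V2_star_subset unfolding r1(2) point_tree_def by blast
  from compact_subsequence_finite[OF ternary_tree_finite(3)[OF s(1)] compact_V2 this]
  obtain r2 :: "nat \<Rightarrow> nat" and q where r2: "strict_mono r2"
    and q: "\<forall>u\<in>internal_nodes s. q u \<in> V2 \<and> (\<lambda>k. (pnt \<circ> snd (x (r1 (r2 k)))) u) \<longlonglongrightarrow> q u" by blast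
  define y where "y k = x (r1 (r2 k))" for k
  have y: "fst (y k) = s" "y k = (s, snd (y k))" for k using r1(2) by (simp_all add: y_def prod_eq_iff)
  have r: "strict_mono (r1 \<circ> r2)" by (rule strict_mono_o[OF r1(1) r2])
  have Y: "triangulation_of (y k) = tree_drawing s (pnt \<circ> snd (y k))" for k
    using y(1)[of k] by (simp add: triangulation_of_def split_beta)
  have A: "triangulation_of a = tree_drawing t (pnt \<circ> lam)" by (simp add: triangulation_of_def a')
  have qlim: "\<forall>u\<in>internal_nodes s. (\<lambda>k. (pnt \<circ> snd (y k)) u) \<longlonglongrightarrow> q u" using q by (simp add: y_def)
  \<comment> \<open>The subsequence of drawings has two Hausdorff limits: the given triangulation,
    and the drawing with the limit points \<open>q\<close>, which so far are known to lie only in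
    the closed simplex.\<close>
  have limit: "tree_drawing t (pnt \<circ> lam) = tree_drawing s q"
  proof (rule hausdorff_limit_unique)
    show "(\<lambda>k. hausdorff_dist (triangulation_of (y k)) (tree_drawing t (pnt \<circ> lam))) \<longlonglongrightarrow> 0"
      using LIMSEQ_subseq_LIMSEQ[OF lim r] by (simp add: o_def y_def A)
    show "(\<lambda>k. hausdorff_dist (triangulation_of (y k)) (tree_drawing s q)) \<longlonglongrightarrow> 0"
      unfolding Y by (rule hausdorff_tree_drawing_tendsto[OF s(1) qlim])
  qed (use compact_tree_drawing s(1) t Y in auto)
  \<comment> \<open>Seen as the drawing of \<open>t\<close>, the limit has one face for each leaf of
    \<open>t\<close>. Both trees have \<open>2n + 1\<close> leaves, so no leaf triangle of
    \<open>s\<close> has collapsed.\<close>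
  have "card (faces (tree_drawing s q)) = card (leaves s)"
    using faces_drawing_bij[of t "pnt \<circ> lam"] CTa(1,2) card_leaves[OF t] card_leaves[OF s(1)] s(2)
    unfolding limit[symmetric] point_tree_def by (metis bij_betw_same_card)
  then have star: "\<forall>u\<in>internal_nodes s. q u \<in> V2_star"
    using V2_star_of_card_faces[OF s(1), of q] q by simp
  have eq: "s = t \<and> (\<forall>u\<in>internal_nodes s. q u = (pnt \<circ> lam) u)"
    by (rule drawing_injective[OF s(1) star, of t "pnt \<circ> lam" ABC, OF _ _ ABC_nondegenerate])
      (use CTa(1) limit in \<open>simp_all add: point_tree_def base_triangle_eq\<close>)
  then have "(\<lambda>k. tree_dist dl dn (t, snd (y k)) (t, lam)) \<longlonglongrightarrow> 0"
    using qlim a a' x y(2) by (intro tree_dist_tendsto_I[OF dl dn, of _ _ n]) (auto simp: y_def)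
  then have "(\<lambda>k. tree_dist dl dn (y k) a) \<longlonglongrightarrow> 0" using y(2) a' eq by simp
  then show ?thesis using r by (intro exI[of _ "r1 \<circ> r2"]) (simp add: y_def o_def)
qed

lemma homeomorphic_map_triangulation_of:
  assumes dl: "usual_distance dl" and dn: "usual_distance dn"
  shows "homeomorphic_map (distance_topology (CT n) (tree_dist dl dn))
    (distance_topology (compact_triangulations n) hausdorff_dist) triangulation_of"
proof -
  let ?d = "restrict_dist (CT n) (tree_dist dl dn)"
  let ?h = "restrict_dist (compact_triangulations n) hausdorff_dist"
  let ?g = "inv_into (CT n) triangulation_of"
  have M: "Metric_space (CT n) ?d" "Metric_space (compact_triangulations n) ?h"
    using dl dn Metric_space_CT Metric_space_compact_triangulations by (auto simp: usual_distance_def)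
  note bij = triangulation_of_bij[of n]
  have img: "triangulation_of y \<in> compact_triangulations n" if "y \<in> CT n" for y
    using bij that by (auto simp: bij_betw_def)
  have g: "?g m \<in> CT n" "triangulation_of (?g m) = m" if "m \<in> compact_triangulations n" for m
    using bij that by (auto simp: bij_betw_def inv_into_into f_inv_into_f)
  have id: "strict_mono (\<lambda>k::nat. k)" by (simp add: strict_mono_def)
  have "continuous_map (Metric_space.mtopology (CT n) ?d)
      (Metric_space.mtopology (compact_triangulations n) ?h) triangulation_of"
  proof (rule continuous_map_subsequences[OF M])
    fix x a assume *: "\<And>k. x k \<in> CT n" "a \<in> CT n" "(\<lambda>k. ?d (x k) a) \<longlonglongrightarrow> 0"
    then have "(\<lambda>k. hausdorff_dist (triangulation_of (x k)) (triangulation_of a)) \<longlonglongrightarrow> 0"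
      by (intro triangulation_of_tendsto[OF dn, of _ n _ dl]) (simp_all add: restrict_dist_def)
    then show "\<exists>r. strict_mono r \<and> (\<lambda>k. ?h (triangulation_of (x (r k))) (triangulation_of a)) \<longlonglongrightarrow> 0"
      using id * img by (intro exI[of _ "\<lambda>k. k"]) (simp add: restrict_dist_def)
  qed (use img in blast)
  moreover have "continuous_map (Metric_space.mtopology (compact_triangulations n) ?h)
      (Metric_space.mtopology (CT n) ?d) ?g"
  proof (rule continuous_map_subsequences[OF M(2,1)])
    fix x a assume *: "\<And>k. x k \<in> compact_triangulations n" "a \<in> compact_triangulations n"
      "(\<lambda>k. ?h (x k) a) \<longlonglongrightarrow> 0"
    then have "(\<lambda>k. hausdorff_dist (triangulation_of (?g (x k))) (triangulation_of (?g a))) \<longlonglongrightarrow> 0"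
      by (simp add: restrict_dist_def g)
    then show "\<exists>r. strict_mono r \<and> (\<lambda>k. ?d (?g (x (r k))) (?g a)) \<longlonglongrightarrow> 0"
      using triangulation_of_subsequence[OF dl dn, of "\<lambda>k. ?g (x k)" n "?g a"] g *(1,2)
      by (simp add: restrict_dist_def)
  qed (use g in blast)
  moreover have "?g (triangulation_of y) = y" if "y \<in> CT n" for y
    using bij that by (auto simp: bij_betw_def)
  ultimately have "homeomorphic_maps (Metric_space.mtopology (CT n) ?d)
      (Metric_space.mtopology (compact_triangulations n) ?h) triangulation_of ?g"
    using g(2) by (simp add: homeomorphic_maps_def Metric_space.topspace_mtopology[OF M(1)]
        Metric_space.topspace_mtopology[OF M(2)])
  then show ?thesis unfolding distance_topology_def homeomorphic_map_maps by blast
qed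

text \<open>Quantifying over all histories of \<open>m\<close> makes the two correspondences
  independent of the order of insertion.\<close>

theorem theorem2p8:
  fixes n :: nat
    and dl :: "real ^ 3 ^ 3 \<Rightarrow> real ^ 3 ^ 3 \<Rightarrow> real"
    and dn :: "(real ^ 3 ^ 3) \<times> (real ^ 3) \<Rightarrow> (real ^ 3 ^ 3) \<times> (real ^ 3) \<Rightarrow> real"
  assumes "usual_distance dl" and "usual_distance dn"
  shows "\<exists>\<Psi>.
    homeomorphic_map
      (distance_topology (CT n) (tree_dist dl dn))
      (distance_topology (compact_triangulations n) hausdorff_dist) \<Psi> \<and>
    (\<forall>t lam m \<sigma> V. (t, lam) \<in> CT n \<longrightarrow> \<Psi> (t, lam) = m \<longrightarrow> triangulation_history n m \<sigma> V \<longrightarrow>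
      (\<exists>\<beta>. bij_betw \<beta> (internal_nodes t) V \<and>
        (\<forall>u\<in>internal_nodes t. \<forall>C P. lam u = NodeLabel C P \<longrightarrow>
          barycentric_coords ABC (weighted_sum C P) (\<beta> u))) \<and>
      (\<exists>\<phi>. bij_betw \<phi> (leaves t) (faces m) \<and>
        (\<forall>l\<in>leaves t. \<forall>C. lam l = LeafLabel C \<longrightarrow>
          (\<exists>v. \<sigma> (\<phi> l) = Some v \<and> (\<forall>i. barycentric_coords ABC (C $ i) (v $ i))))))"
proof (intro exI[of _ triangulation_of] conjI allI impI)
  show "homeomorphic_map (distance_topology (CT n) (tree_dist dl dn))
    (distance_topology (compact_triangulations n) hausdorff_dist) triangulation_of"
    by (rule homeomorphic_map_triangulation_of[OF assms])
  fix t lam m \<sigma> V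
  assume "(t, lam) \<in> CT n" "triangulation_of (t, lam) = m" "triangulation_history n m \<sigma> V"
  then have CT: "(t, lam) \<in> CT n" and history: "triangulation_history n (triangulation_of (t, lam)) \<sigma> V"
    and m: "m = triangulation_of (t, lam)" by auto
  note * = triangulation_of_vertices_faces[OF CT history]
  show "\<exists>\<beta>. bij_betw \<beta> (internal_nodes t) V \<and>
      (\<forall>u\<in>internal_nodes t. \<forall>C P. lam u = NodeLabel C P \<longrightarrow>
        barycentric_coords ABC (weighted_sum C P) (\<beta> u))"
    using *(1,2) by blast
  show "\<exists>\<phi>. bij_betw \<phi> (leaves t) (faces m) \<and>
      (\<forall>l\<in>leaves t. \<forall>C. lam l = LeafLabel C \<longrightarrow>
        (\<exists>v. \<sigma> (\<phi> l) = Some v \<and> (\<forall>i. barycentric_coords ABC (C $ i) (v $ i))))"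
    unfolding m using *(3,4) by blast
qed

end
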